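(* Let $\mathfrak{g}$ be a five-dimensional non-abelian real Lie algebra admitting a coKähler structure. Then $\mathfrak{g}$ is isomorphic to one of the following Lie algebras with basis $e_1,\dots,e_5$ (only non-zero brackets are listed, up to antisymmetry): - $\mathfrak{g}_{1,\alpha}=\mathbb{R}e_5\ltimes\mathbb{R}^4$, $\alpha\in[0,1]$: $[e_5,e_1]=-e_2$, $[e_5,e_2]=e_1$, $[e_5,e_3]=-\alpha e_4$, $[e_5,e_4]=\alpha e_3$; - $\mathfrak{g}_1=\mathbb{R}e_5\ltimes\mathfrak{rr}_{3,0}$: $[e_1,e_2]=e_2$, $[e_5,e_3]=-e_4$, $[e_5,e_4]=e_3$; - $\mathfrak{g}_5=\mathbb{R}e_5\times\mathfrak{rr}_{3,0}$: $[e_1,e_2]=e_2$; - $\mathfrak{g}_2=\mathbb{R}e_5\times\mathfrak{r}_2\mathfrak{r}_2$: $[e_1,e_2]=e_2$, $[e_3,e_4]=e_4$; - $\mathfrak{g}_{6,\delta}=\mathbb{R}e_5\times\mathfrak{r}'_{4,0,\delta}$, $\delta>0$: $[e_4,e_1]=e_1$, $[e_4,e_2]=-\delta e_3$, $[e_4,e_3]=\delta e_2$; - $\mathfrak{g}_3=\mathbb{R}e_5\times\mathfrak{d}_{4,2}$: $[e_1,e_2]=e_3$, $[e_4,e_3]=e_3$, $[e_4,e_1]=2e_1$, $[e_4,e_2]=-e_2$; - $\mathfrak{g}_4=\mathbb{R}e_5\ltimes\mathfrak{d}_{4,\frac12}$: $[e_1,e_2]=e_3$, $[e_4,e_3]=e_3$,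 $[e_4,e_1]=\frac12e_1$, $[e_4,e_2]=\frac12e_2$, $[e_5,e_1]=-e_2$, $[e_5,e_2]=e_1$; - $\mathfrak{g}_7=\mathbb{R}e_5\times\mathfrak{d}_{4,\frac12}$: $[e_1,e_2]=e_3$, $[e_4,e_3]=e_3$, $[e_4,e_1]=\frac12e_1$, $[e_4,e_2]=\frac12e_2$; - $\mathfrak{g}_{8,\delta}=\mathbb{R}e_5\times\mathfrak{d}'_{4,\delta}$, $\delta>0$: $[e_1,e_2]=e_3$, $[e_4,e_1]=\frac{\delta}{2}e_1-e_2$, $[e_4,e_3]=\delta e_3$, $[e_4,e_2]=e_1+\frac{\delta}{2}e_2$. In particular, the first family gives, up to isomorphism, the (non-abelian) flat extensions $\mathbb{R}e_5\ltimes_D\mathfrak{h}$ arising from the Kähler Lie algebras $\mathfrak{h}=\mathbb{R}^4$ and $\mathfrak{h}=\mathfrak{rr}'_{3,0}$, while the remaining lines give the non-flat extensions.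
   Context: CoKähler structure on a real Lie algebra $\mathfrak{g}$ of odd dimension: a quadruple $(J,\xi,\alpha,\langle\cdot,\cdot\rangle)$ with $J$ an endomorphism of $\mathfrak{g}$, $\xi\in\mathfrak{g}$ non-zero, $\alpha\in\mathfrak{g}^*$ and $\langle\cdot,\cdot\rangle$ an inner product such that $\alpha(\xi)=1$, $J^2=-\mathrm{Id}+\alpha\otimes\xi$, $\langle JX,JY\rangle=\langle X,Y\rangle-\alpha(X)\alpha(Y)$, $d\alpha=0$, $N_J=0$, $d\omega=0$, where $\omega(X,Y)=\langle JX,Y\rangle$, $d$ is the Chevalley–Eilenberg differential and $N_J(X,Y)=[JX,JY]-J[JX,Y]-J[X,JY]+J^2[X,Y]$. Extensions: a coKähler Lie algebra decomposes as $\mathfrak{g}=\mathbb{R}\xi\ltimes_D\mathfrak{h}$, where $\mathfrak{h}=\ker\alpha$ is a Kähler Lie algebra (with restricted $J$ and $\langle\cdot,\cdot\rangle$) and $D=\mathrm{ad}_\xi|_{\mathfrak{h}}$ is a skew-symmetric derivation of $\mathfrak{h}$ commuting with $J|_{\mathfrak h}$. Conversely any such $(\mathfrak{h},D)$ gives a coKähler Lie algebra; in dimension five $\xi$ is denoted $e_5$ up to scale. A metric Lie algebra is flat if the curvature of its Levi-Civita connection vanishes; an extension is called flat if its coKähler inner product is flat. $\mathfrak{rr}'_{3,0}$ is the four-dimensional Lie algebra with basis $e_1,\dots,e_4$ and non-zero brackets $[e_1,e_2]=-e_3$, $[e_1,e_3]=e_2$. The names $\mathfrak{rr}_{3,0}$,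 $\mathfrak{r}_2\mathfrak{r}_2$, $\mathfrak{r}'_{4,0,\delta}$, $\mathfrak{d}_{4,2}$, $\mathfrak{d}_{4,\frac12}$, $\mathfrak{d}'_{4,\delta}$ denote the four-dimensional subalgebras spanned by $e_1,\dots,e_4$ with the brackets listed in the claim. *)

theory Defs
  imports "HOL-Analysis.Analysis"
begin

section \<open>Real Lie algebras\<close>

text \<open>A Lie algebra is a real vector space (a type of class \<open>real_vector\<close>) with an explicit bracket.\<close>

definition lie_algebra :: "('a::real_vector \<Rightarrow> 'a \<Rightarrow> 'a) \<Rightarrow> bool" where
  "lie_algebra B \<longleftrightarrow> bilinear B \<and> (\<forall>x. B x x = 0) \<and>
     (\<forall>x y z. B x (B y z) + B y (B z x) + B z (B x y) = 0)"

definition lie_abelian :: "('a::real_vector \<Rightarrow> 'a \<Rightarrow> 'a) \<Rightarrow> bool" where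
  "lie_abelian B \<longleftrightarrow> (\<forall>x y. B x y = 0)"

definition lie_isomorphic ::
    "('a::real_vector \<Rightarrow> 'a \<Rightarrow> 'a) \<Rightarrow> ('b::real_vector \<Rightarrow> 'b \<Rightarrow> 'b) \<Rightarrow> bool" where
  "lie_isomorphic B C \<longleftrightarrow> (\<exists>f. linear f \<and> bij f \<and> (\<forall>x y. f (B x y) = C (f x) (f y)))"

definition lie_derivation :: "('a::real_vector \<Rightarrow> 'a \<Rightarrow> 'a) \<Rightarrow> ('a \<Rightarrow> 'a) \<Rightarrow> bool" where
  "lie_derivation B D \<longleftrightarrow> linear D \<and> (\<forall>x y. D (B x y) = B (D x) y + B x (D y))"

definition inner_product :: "('a::real_vector \<Rightarrow> 'a \<Rightarrow> real) \<Rightarrow> bool" where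
  "inner_product ip \<longleftrightarrow> bilinear ip \<and> (\<forall>x y. ip x y = ip y x) \<and> (\<forall>x. x \<noteq> 0 \<longrightarrow> ip x x > 0)"

text \<open>The Chevalley--Eilenberg differential (trivial coefficients) on 1-forms and 2-forms.\<close>

definition ce_d1 ::
    "('a::real_vector \<Rightarrow> 'a \<Rightarrow> 'a) \<Rightarrow> ('a \<Rightarrow> real) \<Rightarrow> 'a \<Rightarrow> 'a \<Rightarrow> real" where
  "ce_d1 B \<alpha> X Y = - \<alpha> (B X Y)"

definition ce_d2 ::
    "('a::real_vector \<Rightarrow> 'a \<Rightarrow> 'a) \<Rightarrow> ('a \<Rightarrow> 'a \<Rightarrow> real) \<Rightarrow> 'a \<Rightarrow> 'a \<Rightarrow> 'a \<Rightarrow> real" where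
  "ce_d2 B \<omega> X Y Z = - \<omega> (B X Y) Z + \<omega> (B X Z) Y - \<omega> (B Y Z) X"

definition nijenhuis ::
    "('a::real_vector \<Rightarrow> 'a \<Rightarrow> 'a) \<Rightarrow> ('a \<Rightarrow> 'a) \<Rightarrow> 'a \<Rightarrow> 'a \<Rightarrow> 'a" where
  "nijenhuis B J X Y = B (J X) (J Y) - J (B (J X) Y) - J (B X (J Y)) + J (J (B X Y))"


section \<open>Flat metric Lie algebras\<close>

definition levi_civita ::
    "('a::real_vector \<Rightarrow> 'a \<Rightarrow> 'a) \<Rightarrow> ('a \<Rightarrow> 'a \<Rightarrow> real) \<Rightarrow> ('a \<Rightarrow> 'a \<Rightarrow> 'a) \<Rightarrow> bool" where
  "levi_civita B ip \<Gamma> \<longleftrightarrow> bilinear \<Gamma> \<and>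
     (\<forall>X Y. \<Gamma> X Y - \<Gamma> Y X = B X Y) \<and>
     (\<forall>X Y Z. ip (\<Gamma> X Y) Z + ip Y (\<Gamma> X Z) = 0)"

definition curvature ::
    "('a::real_vector \<Rightarrow> 'a \<Rightarrow> 'a) \<Rightarrow> ('a \<Rightarrow> 'a \<Rightarrow> 'a) \<Rightarrow> 'a \<Rightarrow> 'a \<Rightarrow> 'a \<Rightarrow> 'a" where
  "curvature B \<Gamma> X Y Z = \<Gamma> X (\<Gamma> Y Z) - \<Gamma> Y (\<Gamma> X Z) - \<Gamma> (B X Y) Z"

text \<open>In finite dimension the Levi-Civita connection exists and is unique (Koszul formula),
  so the existential quantifier below ranges over exactly one \<open>\<Gamma>\<close>.\<close>

definition flat_metric ::
    "('a::real_vector \<Rightarrow> 'a \<Rightarrow> 'a) \<Rightarrow> ('a \<Rightarrow> 'a \<Rightarrow> real) \<Rightarrow> bool" where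
  "flat_metric B ip \<longleftrightarrow>
     (\<exists>\<Gamma>. levi_civita B ip \<Gamma> \<and> (\<forall>X Y Z. curvature B \<Gamma> X Y Z = 0))"


section \<open>CoKaehler and Kaehler Lie algebras, extensions\<close>

text \<open>\<open>dim\<close> is 0 for spaces that are not finite-dimensional, so odd dimension includes finiteness.\<close>

definition cokaehler ::
    "('a::real_vector \<Rightarrow> 'a \<Rightarrow> 'a) \<Rightarrow> ('a \<Rightarrow> 'a) \<Rightarrow> 'a \<Rightarrow> ('a \<Rightarrow> real) \<Rightarrow> ('a \<Rightarrow> 'a \<Rightarrow> real) \<Rightarrow> bool" where
  "cokaehler B J \<xi> \<alpha> ip \<longleftrightarrow>
     lie_algebra B \<and> odd (dim (UNIV :: 'a set)) \<and>
     linear J \<and> \<xi> \<noteq> 0 \<and> linear \<alpha> \<and> inner_product ip \<and>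
     \<alpha> \<xi> = 1 \<and>
     (\<forall>X. J (J X) = - X + \<alpha> X *\<^sub>R \<xi>) \<and>
     (\<forall>X Y. ip (J X) (J Y) = ip X Y - \<alpha> X * \<alpha> Y) \<and>
     (\<forall>X Y. ce_d1 B \<alpha> X Y = 0) \<and>
     (\<forall>X Y. nijenhuis B J X Y = 0) \<and>
     (\<forall>X Y Z. ce_d2 B (\<lambda>X Y. ip (J X) Y) X Y Z = 0)"

definition kaehler ::
    "('a::real_vector \<Rightarrow> 'a \<Rightarrow> 'a) \<Rightarrow> ('a \<Rightarrow> 'a) \<Rightarrow> ('a \<Rightarrow> 'a \<Rightarrow> real) \<Rightarrow> bool" where
  "kaehler B J ip \<longleftrightarrow>
     lie_algebra B \<and> linear J \<and> inner_product ip \<and>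
     (\<forall>X. J (J X) = - X) \<and>
     (\<forall>X Y. ip (J X) (J Y) = ip X Y) \<and>
     (\<forall>X Y. nijenhuis B J X Y = 0) \<and>
     (\<forall>X Y Z. ce_d2 B (\<lambda>X Y. ip (J X) Y) X Y Z = 0)"

definition extension_data ::
    "('a::real_vector \<Rightarrow> 'a \<Rightarrow> 'a) \<Rightarrow> ('a \<Rightarrow> 'a) \<Rightarrow> ('a \<Rightarrow> 'a \<Rightarrow> real) \<Rightarrow> ('a \<Rightarrow> 'a) \<Rightarrow> bool" where
  "extension_data B J ip D \<longleftrightarrow>
     kaehler B J ip \<and> lie_derivation B D \<and>
     (\<forall>x y. ip (D x) y = - ip x (D y)) \<and> (\<forall>x. D (J x) = J (D x))"

text \<open>The semidirect product \<open>\<real>\<xi> \<ltimes>\<^sub>D \<hh>\<close> on \<open>real \<times> 'a\<close>, with \<open>\<xi> = (1, 0)\<close> acting on \<open>\<hh>\<close> by \<open>D\<close>. Its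
  coKaehler structure has \<open>\<alpha> = fst\<close>, \<open>J\<close> extended by \<open>J \<xi> = 0\<close>, and the inner product
  \<open>ext_inner\<close>: the compatibility axiom forces \<open>\<xi>\<close> to be a unit vector orthogonal to \<open>\<hh>\<close>.\<close>

definition ext_bracket ::
    "('a::real_vector \<Rightarrow> 'a \<Rightarrow> 'a) \<Rightarrow> ('a \<Rightarrow> 'a) \<Rightarrow> real \<times> 'a \<Rightarrow> real \<times> 'a \<Rightarrow> real \<times> 'a" where
  "ext_bracket B D = (\<lambda>(s, x) (t, y). (0, s *\<^sub>R D y - t *\<^sub>R D x + B x y))"

definition ext_J :: "('a \<Rightarrow> 'a) \<Rightarrow> real \<times> 'a \<Rightarrow> real \<times> 'a" where
  "ext_J J = (\<lambda>(s, x). (0, J x))"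

definition ext_inner :: "('a \<Rightarrow> 'a \<Rightarrow> real) \<Rightarrow> real \<times> 'a \<Rightarrow> real \<times> 'a \<Rightarrow> real" where
  "ext_inner ip = (\<lambda>(s, x) (t, y). s * t + ip x y)"

lemma cokaehler_extension:
  fixes C :: "'a::real_vector \<Rightarrow> 'a \<Rightarrow> 'a"
  assumes "extension_data C J ip D" "odd (dim (UNIV::(real\<times>'a) set))"
  shows "cokaehler (ext_bracket C D) (ext_J J) (1,0) fst (ext_inner ip)"
proof -
  have bC: "bilinear C" and bi: "bilinear ip" and lD: "linear D" and lJ: "linear J"
    using assms by (auto simp: extension_data_def kaehler_def lie_algebra_def inner_product_def lie_derivation_def)
  note s = bilinear_ladd[OF bC] bilinear_radd[OF bC] bilinear_lmul[OF bC] bilinear_rmul[OF bC]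
     bilinear_ladd[OF bi] bilinear_radd[OF bi] bilinear_lmul[OF bi] bilinear_rmul[OF bi]
     bilinear_lsub[OF bC] bilinear_rsub[OF bC]  bilinear_lsub[OF bi] bilinear_rsub[OF bi]
     bilinear_lzero[OF bC] bilinear_rzero[OF bC]  bilinear_lzero[OF bi] bilinear_rzero[OF bi]
     bilinear_lneg[OF bC] bilinear_rneg[OF bC]  bilinear_lneg[OF bi] bilinear_rneg[OF bi]
     linear_add[OF lD] linear_diff[OF lD] linear_scale[OF lD] linear_0[OF lD] linear_neg[OF lD]
     linear_add[OF lJ] linear_diff[OF lJ] linear_scale[OF lJ] linear_0[OF lJ] linear_neg[OF lJ]
  have alt: "C x x = 0" for x using assms by (auto simp: extension_data_def kaehler_def lie_algebra_def)
  have anti: "C x y = - C y x" for x y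
    using alt[of "x+y"] alt[of x] alt[of y] by (simp add: s eq_neg_iff_add_eq_0 add.commute)
  have jac: "C x (C y z) + C y (C z x) + C z (C x y) = 0" for x y z
    using assms by (auto simp: extension_data_def kaehler_def lie_algebra_def)
  have K: "kaehler C J ip" and LD: "lie_derivation C D" and sk: "\<And>x y. ip (D x) y = - ip x (D y)"
    and c: "\<And>x. D (J x) = J (D x)"
    using assms(1) unfolding extension_data_def by blast+
  have J2: "\<And>x. J (J x) = - x" and iJ: "\<And>x y. ip (J x) (J y) = ip x y"
    and N: "\<And>x y. nijenhuis C J x y = 0"
    and w: "\<And>x y z. ce_d2 C (\<lambda>X Y. ip (J X) Y) x y z = 0" and IP: "inner_product ip"
    using K unfolding kaehler_def by blast+
  have der: "\<And>x y. D (C x y) = C (D x) y + C x (D y)"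
    using LD unfolding lie_derivation_def by blast
  have sym: "\<And>x y. ip x y = ip y x" and pos: "\<And>x. x \<noteq> 0 \<Longrightarrow> ip x x > 0"
    using IP unfolding inner_product_def by blast+
  have isk: "ip (J x) y = - ip x (J y)" for x y using iJ[of x "J y"] by (simp add: J2 s)
  have 1: "bilinear (ext_bracket C D)"
    unfolding bilinear_def by (auto intro!: linearI simp: ext_bracket_def s algebra_simps scaleR_add_right)
  have 2: "ext_bracket C D x (ext_bracket C D y z) + ext_bracket C D y (ext_bracket C D z x) + ext_bracket C D z (ext_bracket C D x y) = 0" for x y z
    using jac[of "snd x" "snd y" "snd z"]
    by (cases x; cases y; cases z) (auto simp: ext_bracket_def s der algebra_simps zero_prod_def anti[of "D _" "_"])
  have pos': "0 < a * a + ip b b" if "(a, b) \<noteq> 0" for a b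
  proof (cases "b = 0")
    case True
    then show ?thesis using that
      by (simp add: zero_prod_def bilinear_lzero[OF bi]) (metis not_real_square_gt_zero)
  qed (simp add: pos add_nonneg_pos)
  have 3: "inner_product (ext_inner ip)"
    unfolding inner_product_def bilinear_def
    by (auto intro!: linearI pos' simp: ext_inner_def s algebra_simps sym)
  have 4: "nijenhuis (ext_bracket C D) (ext_J J) X Y = 0" for X Y
    using N[of "snd X" "snd Y"] by (cases X; cases Y) (auto simp: nijenhuis_def ext_bracket_def ext_J_def s c J2 algebra_simps zero_prod_def)
  have 5: "ce_d2 (ext_bracket C D) (\<lambda>X Y. ext_inner ip (ext_J J X) Y) X Y Z = 0" for X Y Z
  proof (cases X; cases Y; cases Z)
    fix a x b y c' z assume [simp]: "X=(a,x)" "Y = (b,y)" "Z = (c',z)"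
    have e: "ip (J (D u)) v = ip (J (D v)) u" for u v
      by (metis c isk sk sym minus_minus)
    show ?thesis using w[of x y z] e[of x y] e[of x z] e[of y z]
      by (simp add: ce_d2_def ext_bracket_def ext_J_def ext_inner_def s algebra_simps)
  qed
  have "linear (ext_J J)" "linear (fst :: real\<times>'a \<Rightarrow> real)" by (auto intro!: linearI simp: ext_J_def s)
  then show ?thesis using 1 2 3 4 5 assms(2)
    by (auto simp: cokaehler_def lie_algebra_def ext_bracket_def ext_J_def ext_inner_def alt J2 iJ ce_d1_def zero_prod_def)
qed


section \<open>The Lie algebras in the classification\<close>

text \<open>The bilinear alternating bracket with \<open>[e\<^sub>i, e\<^sub>j] = v\<close> for every entry \<open>(i, j, v)\<close> of the list
  (each unordered pair \<open>i \<noteq> j\<close> occurring at most once) and zero on all other pairs of basis vectors.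
  In the index type \<open>5\<close> the numerals \<open>1, 2, 3, 4, 5\<close> are distinct (\<open>5 = 0\<close>); likewise for \<open>4\<close>.\<close>

definition table_bracket ::
    "('n::finite \<times> 'n \<times> (real^'n)) list \<Rightarrow> real^'n \<Rightarrow> real^'n \<Rightarrow> real^'n" where
  "table_bracket T x y = (\<Sum>(i, j, v)\<leftarrow>T. (x $ i * y $ j - x $ j * y $ i) *\<^sub>R v)"

abbreviation \<ee> :: "'n::finite \<Rightarrow> real^'n" where
  "\<ee> i \<equiv> axis i 1"

definition abelian4 :: "real^4 \<Rightarrow> real^4 \<Rightarrow> real^4" where
  "abelian4 = table_bracket []"

definition rr'_3_0 :: "real^4 \<Rightarrow> real^4 \<Rightarrow> real^4" where
  "rr'_3_0 = table_bracket [(1, 2, - \<ee> 3), (1, 3, \<ee> 2)]"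

definition \<gg>1_fam :: "real \<Rightarrow> real^5 \<Rightarrow> real^5 \<Rightarrow> real^5" where
  "\<gg>1_fam a = table_bracket
     [(5, 1, - \<ee> 2), (5, 2, \<ee> 1), (5, 3, - (a *\<^sub>R \<ee> 4)), (5, 4, a *\<^sub>R \<ee> 3)]"

definition \<gg>1 :: "real^5 \<Rightarrow> real^5 \<Rightarrow> real^5" where
  "\<gg>1 = table_bracket [(1, 2, \<ee> 2), (5, 3, - \<ee> 4), (5, 4, \<ee> 3)]"

definition \<gg>5 :: "real^5 \<Rightarrow> real^5 \<Rightarrow> real^5" where
  "\<gg>5 = table_bracket [(1, 2, \<ee> 2)]"

definition \<gg>2 :: "real^5 \<Rightarrow> real^5 \<Rightarrow> real^5" where
  "\<gg>2 = table_bracket [(1, 2, \<ee> 2), (3, 4, \<ee> 4)]"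

definition \<gg>6_fam :: "real \<Rightarrow> real^5 \<Rightarrow> real^5 \<Rightarrow> real^5" where
  "\<gg>6_fam \<delta> = table_bracket [(4, 1, \<ee> 1), (4, 2, - (\<delta> *\<^sub>R \<ee> 3)), (4, 3, \<delta> *\<^sub>R \<ee> 2)]"

definition \<gg>3 :: "real^5 \<Rightarrow> real^5 \<Rightarrow> real^5" where
  "\<gg>3 = table_bracket [(1, 2, \<ee> 3), (4, 3, \<ee> 3), (4, 1, 2 *\<^sub>R \<ee> 1), (4, 2, - \<ee> 2)]"

definition \<gg>4 :: "real^5 \<Rightarrow> real^5 \<Rightarrow> real^5" where
  "\<gg>4 = table_bracket
     [(1, 2, \<ee> 3), (4, 3, \<ee> 3), (4, 1, (1/2) *\<^sub>R \<ee> 1), (4, 2, (1/2) *\<^sub>R \<ee> 2),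
      (5, 1, - \<ee> 2), (5, 2, \<ee> 1)]"

definition \<gg>7 :: "real^5 \<Rightarrow> real^5 \<Rightarrow> real^5" where
  "\<gg>7 = table_bracket
     [(1, 2, \<ee> 3), (4, 3, \<ee> 3), (4, 1, (1/2) *\<^sub>R \<ee> 1), (4, 2, (1/2) *\<^sub>R \<ee> 2)]"

definition \<gg>8_fam :: "real \<Rightarrow> real^5 \<Rightarrow> real^5 \<Rightarrow> real^5" where
  "\<gg>8_fam \<delta> = table_bracket
     [(1, 2, \<ee> 3), (4, 1, (\<delta>/2) *\<^sub>R \<ee> 1 - \<ee> 2), (4, 3, \<delta> *\<^sub>R \<ee> 3), (4, 2, \<ee> 1 + (\<delta>/2) *\<^sub>R \<ee> 2)]"

definition first_family :: "(real^5 \<Rightarrow> real^5 \<Rightarrow> real^5) set" where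
  "first_family = {\<gg>1_fam a | a. 0 \<le> a \<and> a \<le> 1}"

definition remaining_lines :: "(real^5 \<Rightarrow> real^5 \<Rightarrow> real^5) set" where
  "remaining_lines =
     {\<gg>1, \<gg>5, \<gg>2, \<gg>3, \<gg>4, \<gg>7} \<union> {\<gg>6_fam \<delta> | \<delta>. \<delta> > 0} \<union> {\<gg>8_fam \<delta> | \<delta>. \<delta> > 0}"

end

theory Submission
  imports Defs
begin

text \<open>A coKaehler Lie algebra is \<open>\<real>\<xi> \<ltimes>\<^sub>D \<hh>\<close> with \<open>\<hh> = ker \<alpha>\<close> Kaehler, so everything reduces to pairs \<open>(\<hh>, D)\<close> with
  \<open>dim \<hh> = 4\<close>. No four-dimensional Lie algebra is perfect, so there is a codimension-one ideal \<open>k\<close> containing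
  \<open>[\<hh>, \<hh>]\<close>, and it can be chosen such that \<open>tr ad\<^sub>x = 0\<close> for \<open>x \<in> k\<close>. In a unitary basis with
  \<open>e\<^sub>4 \<bottom> k\<close> the unimodular algebra \<open>k\<close> is given by a symmetric matrix \<open>L\<close> via
  \<open>[x, y] = L (x \<times> y)\<close>, the Kaehler conditions determine \<open>A = ad e\<^sub>4\<close> from \<open>L\<close> up to two real parameters, and
  the Jacobi identity is the quadratic matrix equation \<open>A L + L A\<^sup>T = (tr A) L\<close>. A rotation in the
  \<open>e\<^sub>1, e\<^sub>2\<close>-plane makes the upper left block of \<open>L\<close> diagonal, and then the equation has five families of
  solutions. Flatness is detected by the absence of \<open>x\<close>, \<open>y \<noteq> 0\<close> with \<open>[x, y] = y\<close>.\<close>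

section \<open>Isomorphisms and flatness\<close>

text \<open>The trace condition on \<open>k\<close> is what makes \<open>L\<close> symmetric:
  \<open>ad x\<close> maps into \<open>k\<close>, so for \<open>x \<in> k\<close> its trace on
  \<open>k\<close> vanishes too, and this trace form is the skew part of \<open>L\<close>. Fixing
  \<open>e4\<close> fixes \<open>e3 = - J e4\<close>, so unitary changes of basis can only rotate
  the \<open>e1\<close>, \<open>e2\<close>-plane. The entries of \<open>L\<close> outside the upper
  left block therefore survive into the case analysis. The cases are governed by
  \<open>\<tau> = tr A\<close>. Pairing \<open>A L + L A^T = \<tau> L\<close> with the adjugate of
  \<open>L\<close> gives \<open>2 \<tau> det L = 3 \<tau> det L\<close>. Either
  \<open>\<tau> = 0\<close>, that is \<open>\<hh>\<close> is unimodular, and the (3,3) entry of the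
  equation makes the last column of \<open>L\<close> vanish, which leads to the flat family; or
  \<open>det L = 0\<close>. Non-flatness concerns a given metric, whereas the classification is up
  to isomorphism of brackets. An eigenvector \<open>[x, y] = y\<close> mediates between the two: it
  depends on the bracket alone, passes from \<open>\<hh>\<close> to every extension and obstructs
  flatness for every inner product. Its absence in \<open>abelian4\<close> and
  \<open>rr'_3_0\<close> separates the two alternatives.\<close>

lemma linear_bij_inv:
  fixes f :: "'a::real_vector \<Rightarrow> 'b::real_vector"
  assumes "linear f" "bij f"
  shows "linear (inv f)"
proof (rule linearI)
  have f: "f (inv f x) = x" "inv f (f z) = z" for x z
    using assms(2) by (simp_all add: bij_is_inj bij_is_surj surj_f_inv_f)
  show "inv f (x + y) = inv f x + inv f y" for x y
    using f(2)[of "inv f x + inv f y"] by (simp add: linear_add[OF assms(1)] f(1))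
  show "inv f (c *\<^sub>R x) = c *\<^sub>R inv f x" for c x
    using f(2)[of "c *\<^sub>R inv f x"] by (simp add: linear_scale[OF assms(1)] f(1))
qed

lemma lie_isomorphicI:
  assumes "linear f" "bij f" "\<And>x y. f (B x y) = C (f x) (f y)"
  shows "lie_isomorphic B C"
  using assms unfolding lie_isomorphic_def by blast

lemma lie_isomorphic_sym:
  assumes "lie_isomorphic B C"
  shows "lie_isomorphic C B"
proof -
  obtain f where f: "linear f" "bij f" "\<And>x y. f (B x y) = C (f x) (f y)"
    using assms unfolding lie_isomorphic_def by blast
  have "inv f (C x y) = B (inv f x) (inv f y)" for x y
    by (metis f(2,3) bij_inv_eq_iff)
  then show ?thesis
    using f linear_bij_inv bij_imp_bij_inv by (intro lie_isomorphicI[of "inv f"]) auto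
qed

lemma lie_isomorphic_trans:
  assumes "lie_isomorphic B C" "lie_isomorphic C D"
  shows "lie_isomorphic B D"
proof -
  obtain f g where f: "linear f" "bij f" "\<And>x y. f (B x y) = C (f x) (f y)"
    and g: "linear g" "bij g" "\<And>x y. g (C x y) = D (g x) (g y)"
    using assms unfolding lie_isomorphic_def by blast
  show ?thesis
    by (rule lie_isomorphicI[of "g \<circ> f"]) (use f g in \<open>auto simp: linear_compose bij_comp\<close>)
qed

lemma lie_abelian_transfer:
  assumes "lie_isomorphic B C" "lie_abelian B"
  shows "lie_abelian C"
proof -
  obtain f where f: "linear f" "bij f" "\<And>x y. f (B x y) = C (f x) (f y)"
    using assms unfolding lie_isomorphic_def by blast
  show ?thesis
    unfolding lie_abelian_def
    by (metis f linear_0 bij_is_surj surjD assms(2) lie_abelian_def)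
qed

text \<open>Equivalently, some \<open>ad\<^sub>x\<close> has a non-zero real eigenvalue.\<close>

definition has_ad_eigenvector :: "('a::real_vector \<Rightarrow> 'a \<Rightarrow> 'a) \<Rightarrow> bool" where
  "has_ad_eigenvector B \<longleftrightarrow> (\<exists>x y. y \<noteq> 0 \<and> B x y = y)"

lemma has_ad_eigenvector_transfer:
  assumes "lie_isomorphic B C" "has_ad_eigenvector B"
  shows "has_ad_eigenvector C"
proof -
  obtain f where f: "linear f" "bij f" "\<And>x y. f (B x y) = C (f x) (f y)"
    using assms unfolding lie_isomorphic_def by blast
  obtain x y where "y \<noteq> 0" "B x y = y" using assms unfolding has_ad_eigenvector_def by blast
  then have "f y \<noteq> 0" "C (f x) (f y) = f y"
    by (metis f(1,2) linear_0 bij_is_inj injD) (metis f(3) \<open>B x y = y\<close>)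
  then show ?thesis unfolding has_ad_eigenvector_def by blast
qed

lemma bilinear_pull:
  assumes "linear f" "bilinear \<Gamma>" "linear g"
  shows "bilinear (\<lambda>x y. g (\<Gamma> (f x) (f y)))"
  using assms unfolding bilinear_def
  by (simp add: linear_iff)

lemma flat_metric_transfer:
  assumes f: "linear f" "bij f" "\<And>x y. f (B x y) = C (f x) (f y)"
    and iso: "\<And>x y. ip x y = ip' (f x) (f y)"
    and "flat_metric C ip'"
  shows "flat_metric B ip"
proof -
  obtain \<Gamma> where G: "bilinear \<Gamma>" "\<And>X Y. \<Gamma> X Y - \<Gamma> Y X = C X Y"
     "\<And>X Y Z. ip' (\<Gamma> X Y) Z + ip' Y (\<Gamma> X Z) = 0" "\<And>X Y Z. curvature C \<Gamma> X Y Z = 0"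
    using assms(5) unfolding flat_metric_def levi_civita_def by auto
  have [simp]: "f (inv f x) = x" "inv f (f z) = z" for x z
    using f(2) by (simp_all add: bij_is_inj bij_is_surj surj_f_inv_f)
  define \<Delta> where "\<Delta> x y = inv f (\<Gamma> (f x) (f y))" for x y
  have eqI: "a = b" if "f a = f b" for a b using that \<open>bij f\<close> by (simp add: bij_is_inj inj_eq)
  have "bilinear \<Delta>" unfolding \<Delta>_def by (rule bilinear_pull[OF f(1) G(1) linear_bij_inv[OF f(1,2)]])
  moreover have "\<Delta> X Y - \<Delta> Y X = B X Y" for X Y
    by (rule eqI) (simp add: \<Delta>_def linear_diff[OF f(1)] G f(3))
  moreover have "ip (\<Delta> X Y) Z + ip Y (\<Delta> X Z) = 0" for X Y Z
    by (simp add: iso \<Delta>_def G)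
  moreover have "curvature B \<Delta> X Y Z = 0" for X Y Z
    using G(4)[of "f X" "f Y" "f Z"]
    by (intro eqI) (simp add: curvature_def \<Delta>_def linear_diff[OF f(1)] linear_0[OF f(1)] f(3))
  ultimately show ?thesis unfolding flat_metric_def levi_civita_def by blast
qed

lemma flat_metric_cong:
  assumes f: "linear f" "bij f" "\<And>x y. f (B x y) = C (f x) (f y)"
    and iso: "\<And>x y. ip x y = ip' (f x) (f y)"
  shows "flat_metric B ip \<longleftrightarrow> flat_metric C ip'"
proof
  have [simp]: "f (inv f x) = x" for x
    using f by (simp add: bij_is_surj surj_f_inv_f)
  have i: "inv f (C x y) = B (inv f x) (inv f y)" for x y
    by (metis f(2,3) bij_inv_eq_iff)
  show "flat_metric C ip'" if "flat_metric B ip"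
  proof (rule flat_metric_transfer[OF linear_bij_inv[OF f(1,2)] bij_imp_bij_inv[OF f(2)] i _ that])
    show "ip' x y = ip (inv f x) (inv f y)" for x y by (simp add: iso)
  qed
  show "flat_metric B ip" if "flat_metric C ip'"
    using f iso that by (rule flat_metric_transfer)
qed

text \<open>Transport of structure against \<open>f\<close>. It replaces a bracket on an arbitrary
  four-dimensional space, or one in an inconvenient basis, by an isomorphic bracket on
  \<open>real^4\<close>.\<close>

definition pull :: "('a \<Rightarrow> 'b) \<Rightarrow> ('b \<Rightarrow> 'b \<Rightarrow> 'b) \<Rightarrow> 'a \<Rightarrow> 'a \<Rightarrow> 'a" where
  "pull f C x y = inv f (C (f x) (f y))"

locale linear_bij =
  fixes f :: "'a::real_vector \<Rightarrow> 'b::real_vector"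
  assumes lin: "linear f" and bij: "bij f"
begin

lemma f_inv [simp]: "f (inv f x) = x" "inv f (f z) = z"
  using bij by (simp_all add: bij_is_inj bij_is_surj surj_f_inv_f)

lemma eqI: "f a = f b \<Longrightarrow> a = b"
  using bij by (simp add: bij_is_inj inj_eq)

lemma lin_inv: "linear (inv f)"
  using lin bij by (rule linear_bij_inv)

lemmas push = linear_add[OF lin] linear_diff[OF lin] linear_neg[OF lin] linear_scale[OF lin] linear_0[OF lin]

lemma lie_isomorphic_pull: "lie_isomorphic (pull f C) C"
  by (rule lie_isomorphicI[OF lin bij]) (simp add: pull_def)

lemma extension_data_pull:
  assumes "extension_data C J ip D"
  shows "extension_data (pull f C) (inv f \<circ> J \<circ> f) (\<lambda>x y. ip (f x) (f y)) (inv f \<circ> D \<circ> f)"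
proof -
  have K: "kaehler C J ip" and LD: "lie_derivation C D" and sk: "\<And>x y. ip (D x) y = - ip x (D y)"
    and c: "\<And>x. D (J x) = J (D x)"
    using assms(1) unfolding extension_data_def by blast+
  have L: "bilinear C" "\<And>x. C x x = 0" "\<And>x y z. C x (C y z) + C y (C z x) + C z (C x y) = 0"
    and lJ: "linear J" and J2: "\<And>x. J (J x) = - x" and iJ: "\<And>x y. ip (J x) (J y) = ip x y"
    and N: "\<And>x y. nijenhuis C J x y = 0"
    and w: "\<And>x y z. ce_d2 C (\<lambda>X Y. ip (J X) Y) x y z = 0" and IP: "inner_product ip"
    using K unfolding kaehler_def lie_algebra_def by blast+
  have lD: "linear D" and der: "\<And>x y. D (C x y) = C (D x) y + C x (D y)"
    using LD unfolding lie_derivation_def by blast+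
  have f0: "f x \<noteq> 0" if "x \<noteq> 0" for x using that eqI[of x 0] by (auto simp: push)
  have la: "lie_algebra (pull f C)"
    unfolding lie_algebra_def
  proof (intro conjI allI)
    show "bilinear (pull f C)"
      using bilinear_pull[OF lin L(1) lin_inv] by (simp add: pull_def[abs_def])
    show "pull f C x (pull f C y z) + pull f C y (pull f C z x) + pull f C z (pull f C x y) = 0" for x y z
      by (rule eqI) (simp add: push pull_def L)
    show "pull f C x x = 0" for x by (simp add: pull_def L linear_0[OF lin_inv])
  qed
  have "inner_product (\<lambda>x y. ip (f x) (f y))"
    using IP f0 by (auto simp: inner_product_def bilinear_def linear_iff push)
  moreover have "(inv f \<circ> J \<circ> f) ((inv f \<circ> J \<circ> f) x) = - x" for x
    by (rule eqI) (simp add: J2 push)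
  moreover have "nijenhuis (pull f C) (inv f \<circ> J \<circ> f) x y = 0" for x y
    by (rule eqI) (use N[of "f x" "f y"] in \<open>simp add: push pull_def nijenhuis_def\<close>)
  moreover have "ce_d2 (pull f C) (\<lambda>X Y. ip (f ((inv f \<circ> J \<circ> f) X)) (f Y)) x y z = 0" for x y z
    using w[of "f x" "f y" "f z"] by (simp add: push pull_def ce_d2_def)
  moreover have "linear (inv f \<circ> J \<circ> f)" using lin lJ lin_inv by (intro linear_compose)
  moreover have "ip (f ((inv f \<circ> J \<circ> f) x)) (f ((inv f \<circ> J \<circ> f) y)) = ip (f x) (f y)" for x y
    by (simp add: iJ)
  ultimately have K': "kaehler (pull f C) (inv f \<circ> J \<circ> f) (\<lambda>x y. ip (f x) (f y))"
    unfolding kaehler_def using la by blast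
  have "lie_derivation (pull f C) (inv f \<circ> D \<circ> f)"
    unfolding lie_derivation_def
  proof (intro conjI allI)
    show "linear (inv f \<circ> D \<circ> f)" using lin lD lin_inv by (intro linear_compose)
    show "(inv f \<circ> D \<circ> f) (pull f C x y) =
        pull f C ((inv f \<circ> D \<circ> f) x) y + pull f C x ((inv f \<circ> D \<circ> f) y)" for x y
      by (rule eqI) (simp add: push pull_def der)
  qed
  moreover have "ip (f ((inv f \<circ> D \<circ> f) x)) (f y) = - ip (f x) (f ((inv f \<circ> D \<circ> f) y))" for x y
    by (simp add: sk)
  moreover have "(inv f \<circ> D \<circ> f) ((inv f \<circ> J \<circ> f) x) = (inv f \<circ> J \<circ> f) ((inv f \<circ> D \<circ> f) x)" for x
    by (simp add: c)
  ultimately show ?thesis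
    unfolding extension_data_def using K' by blast
qed

lemma map_prod_lin: "linear (map_prod id f :: real \<times> 'a \<Rightarrow> real \<times> 'b)"
  by (auto intro!: linearI simp: push)

lemma map_prod_bij: "bij (map_prod id f :: real \<times> 'a \<Rightarrow> real \<times> 'b)"
  using bij by (simp add: bij_def prod.inj_map map_prod_surj)

lemma map_prod_ext_bracket:
  "map_prod id f (ext_bracket (pull f C) (inv f \<circ> D \<circ> f) x y) =
     ext_bracket C D (map_prod id f x) (map_prod id f y)"
  by (cases x; cases y) (simp add: ext_bracket_def push pull_def)

lemma lie_isomorphic_ext_pull:
  "lie_isomorphic (ext_bracket (pull f C) (inv f \<circ> D \<circ> f)) (ext_bracket C D)"
  unfolding lie_isomorphic_def using map_prod_lin map_prod_bij map_prod_ext_bracket by blast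

lemma flat_metric_ext_pull:
  "flat_metric (ext_bracket (pull f C) (inv f \<circ> D \<circ> f)) (ext_inner (\<lambda>x y. ip (f x) (f y))) \<longleftrightarrow>
   flat_metric (ext_bracket C D) (ext_inner ip)"
proof -
  have "ext_inner (\<lambda>x y. ip (f x) (f y)) u v = ext_inner ip (map_prod id f u) (map_prod id f v)" for u v
    by (cases u; cases v) (simp add: ext_inner_def)
  from flat_metric_cong[of "map_prod id f" "ext_bracket (pull f C) (inv f \<circ> D \<circ> f)" "ext_bracket C D"
     "ext_inner (\<lambda>x y. ip (f x) (f y))" "ext_inner ip", OF map_prod_lin map_prod_bij map_prod_ext_bracket this]
  show ?thesis by this
qed

end

text \<open>The Levi-Civita connection is \<open>\<Gamma> x = l x R\<close>. Its values commute,
  being multiples of one endomorphism, and \<open>l\<close> vanishes on brackets because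
  \<open>l \<circ> R = 0\<close>, so both parts of the curvature vanish. All flat extensions below
  have this form.\<close>

lemma flat_metricI:
  assumes R: "linear R" and l: "linear l" and ip: "inner_product ip"
    and skew: "\<And>x y. ip (R x) y = - ip x (R y)" and lR: "\<And>x. l (R x) = (0::real)"
    and B: "\<And>x y. B x y = l x *\<^sub>R R y - l y *\<^sub>R R x"
  shows "flat_metric B ip"
proof -
  have bi: "bilinear ip" using ip by (simp add: inner_product_def)
  have "bilinear (\<lambda>x y. l x *\<^sub>R R y)"
    unfolding bilinear_def
    by (intro conjI allI linearI)
      (simp_all add: linear_add[OF R] linear_scale[OF R] linear_add[OF l] linear_scale[OF l]
         scaleR_add_left scaleR_add_right)
  moreover have "l x *\<^sub>R R y - l y *\<^sub>R R x = B x y" for x y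
    by (simp add: B)
  moreover have "ip (l x *\<^sub>R R y) z + ip y (l x *\<^sub>R R z) = 0" for x y z
    by (simp add: bilinear_lmul[OF bi] bilinear_rmul[OF bi] skew)
  moreover have "curvature B (\<lambda>x y. l x *\<^sub>R R y) X Y Z = 0" for X Y Z
    by (simp add: curvature_def B lR linear_scale[OF R] linear_scale[OF l] linear_diff[OF l])
  ultimately show ?thesis unfolding flat_metric_def levi_civita_def by blast
qed

text \<open>The composition of a skew and a symmetric endomorphism has trace \<open>0\<close>; applied to the flat
  connection this gives \<open>\<parallel>\<Gamma> y\<parallel>\<^sup>2 = \<langle>[\<Gamma> x, \<Gamma> y], \<Gamma> y\<rangle> = 0\<close> for the Frobenius norm whenever \<open>[x, y] = y\<close>.\<close>

lemma flat_metric_no_ad_eigenvector: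
  fixes B :: "'a::euclidean_space \<Rightarrow> 'a \<Rightarrow> 'a"
  assumes "flat_metric B (\<bullet>)"
  shows "\<not> has_ad_eigenvector B"
proof
  assume "has_ad_eigenvector B"
  then obtain x y where xy: "y \<noteq> 0" "B x y = y" unfolding has_ad_eigenvector_def by blast
  obtain \<Gamma> where G: "bilinear \<Gamma>" "\<And>X Y. \<Gamma> X Y - \<Gamma> Y X = B X Y"
     "\<And>X Y Z. \<Gamma> X Y \<bullet> Z + Y \<bullet> \<Gamma> X Z = 0" "\<And>X Y Z. curvature B \<Gamma> X Y Z = 0"
    using assms unfolding flat_metric_def levi_civita_def by auto
  define S A where "S = \<Gamma> x" and "A = \<Gamma> y"
  have skew: "S u \<bullet> v = - (u \<bullet> S v)" "A u \<bullet> v = - (u \<bullet> A v)" for u v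
    using G(3)[of x u v] G(3)[of y u v] by (auto simp: S_def A_def)
  have comm: "A u = S (A u) - A (S u)" for u
    using G(4)[of x y u] xy by (simp add: curvature_def S_def A_def)
  have self: "S u \<bullet> u = 0" for u using skew(1)[of u u] by (simp add: inner_commute)
  define T where "T b c = (S b \<bullet> c) * (A (A b) \<bullet> c)" for b c
  have anti: "T b c = - T c b" for b c
    unfolding T_def using skew by (metis inner_commute minus_minus mult_minus_left)
  have "(\<Sum>b\<in>Basis. \<Sum>c\<in>Basis. T b c) = (\<Sum>b\<in>Basis. \<Sum>c\<in>Basis. - T b c)"
    by (subst sum.swap) (subst anti, rule refl)
  then have z: "(\<Sum>b\<in>Basis. \<Sum>c\<in>Basis. T b c) = 0" by (simp add: sum_negf)
  have "(\<Sum>b\<in>Basis. A b \<bullet> A b) = (\<Sum>b\<in>Basis. S b \<bullet> A (A b))"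
  proof (rule sum.cong)
    fix b :: 'a
    have "A b \<bullet> A b = S (A b) \<bullet> A b - A (S b) \<bullet> A b"
      by (metis comm inner_diff_left)
    then show "A b \<bullet> A b = S b \<bullet> A (A b)" by (simp add: self skew(2)[of "S b"])
  qed simp
  also have "\<dots> = (\<Sum>b\<in>Basis. \<Sum>c\<in>Basis. T b c)"
    unfolding T_def by (intro sum.cong refl) (rule euclidean_inner)
  finally have "(\<Sum>b\<in>Basis. A b \<bullet> A b) = 0" using z by simp
  then have "A b = 0" if "b \<in> Basis" for b
    using that by (subst (asm) sum_nonneg_eq_0_iff) auto
  moreover have "linear A" using G(1) unfolding bilinear_def A_def by blast
  ultimately have "A u = 0" for u
    using linear_eq_stdbasis[of A "\<lambda>_. 0"] by (auto simp: linear_zero)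
  \<comment> \<open>With \<open>\<Gamma> y = 0\<close> the torsion-free condition turns
    \<open>[x, y] = y\<close> into a real eigenvector of the skew map
    \<open>\<Gamma> x\<close>.\<close>
  then have "\<Gamma> x y = y" using G(2)[of x y] xy by (simp add: A_def)
  then show False using self[of y] xy by (simp add: S_def)
qed

section \<open>Coordinates and bracket tables\<close>

definition vec4 :: "real \<Rightarrow> real \<Rightarrow> real \<Rightarrow> real \<Rightarrow> real^4" where
  "vec4 a b c d = (\<chi> i. if i = 1 then a else if i = 2 then b else if i = 3 then c else d)"

lemma vec4_nth [simp]: "vec4 a b c d $ 1 = a" "vec4 a b c d $ 2 = b" "vec4 a b c d $ 3 = c" "vec4 a b c d $ 4 = d"
  by (simp_all add: vec4_def)

lemma vec4_eqI: "x $ 1 = y $ 1 \<Longrightarrow> x $ 2 = y $ 2 \<Longrightarrow> x $ 3 = y $ 3 \<Longrightarrow> x $ 4 = y $ 4 \<Longrightarrow> x = (y::real^4)"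
  by (simp add: vec_eq_iff forall_4)

lemma vec4_eta: "(x::real^4) = vec4 (x $ 1) (x $ 2) (x $ 3) (x $ 4)"
  by (rule vec4_eqI) simp_all

lemma vec4_arith [simp]:
  "vec4 a b c d + vec4 a' b' c' d' = vec4 (a + a') (b + b') (c + c') (d + d')"
  "vec4 a b c d - vec4 a' b' c' d' = vec4 (a - a') (b - b') (c - c') (d - d')"
  "- vec4 a b c d = vec4 (- a) (- b) (- c) (- d)"
  "r *\<^sub>R vec4 a b c d = vec4 (r * a) (r * b) (r * c) (r * d)"
  "vec4 a b c d = vec4 a' b' c' d' \<longleftrightarrow> a = a' \<and> b = b' \<and> c = c' \<and> d = d'"
  "vec4 a b c d = 0 \<longleftrightarrow> a = 0 \<and> b = 0 \<and> c = 0 \<and> d = 0"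
  "vec4 a b c d \<bullet> vec4 a' b' c' d' = a * a' + b * b' + c * c' + d * d'"
  by (auto intro!: vec4_eqI simp: inner_vec_def sum_4 vec_eq_iff forall_4)

lemma zero_vec4: "0 = vec4 0 0 0 0"
  by (rule vec4_eqI) simp_all

lemma inner_vec4: "(x::real^4) \<bullet> y = x $ 1 * y $ 1 + x $ 2 * y $ 2 + x $ 3 * y $ 3 + x $ 4 * y $ 4"
  by (simp add: inner_vec_def sum_4)

lemma exhaust_5: "x = 1 \<or> x = 2 \<or> x = 3 \<or> x = 4 \<or> x = (5::5)"
proof (induct x)
  case (of_int z)
  then have "0 \<le> z" and "z < 5" by simp_all
  \<comment> \<open>The representative \<open>0\<close> is the index written
    \<open>5\<close>.\<close>
  then have "z = 0 \<or> z = 1 \<or> z = 2 \<or> z = 3 \<or> z = 4" by arith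
  then show ?case by auto
qed

lemma forall_5: "(\<forall>i::5. P i) \<longleftrightarrow> P 1 \<and> P 2 \<and> P 3 \<and> P 4 \<and> P 5"
  by (metis exhaust_5)

lemma bilinear_table_bracket: "bilinear (table_bracket T)"
proof (induction T)
  case Nil
  then show ?case by (simp add: bilinear_def table_bracket_def linear_iff)
next
  case (Cons p T)
  then show ?case
    by (cases p) (simp add: bilinear_def table_bracket_def linear_iff algebra_simps)
qed

lemma table_bracket_self: "table_bracket T x x = 0"
  by (induction T) (auto simp: table_bracket_def mult.commute)

lemma bilinear_alternating_swap:
  assumes "bilinear B" "\<And>x. B x x = 0"
  shows "B x y = - B y x"
  using assms(2)[of "x + y"] assms(2)[of x] assms(2)[of y]
  by (simp add: bilinear_ladd[OF assms(1)] bilinear_radd[OF assms(1)] eq_neg_iff_add_eq_0 add.commute)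

text \<open>A vector outside the range would enlarge the image of \<open>Basis\<close> to an
  independent set with more elements than a spanning set of the target.\<close>

lemma bij_of_inj_linear:
  fixes f :: "'a::euclidean_space \<Rightarrow> 'b::real_vector"
  assumes f: "linear f" "inj f" and dim: "dim (UNIV :: 'b set) = DIM('a)"
  shows "bij f"
proof -
  have ind: "independent (f ` Basis)"
    using f by (intro linear_independent_injective_image) (auto simp: independent_Basis)
  have "card (f ` Basis) = DIM('a)" using f(2) by (simp add: card_image inj_on_subset)
  obtain S :: "'b set" where S: "independent S" "UNIV \<subseteq> span S" "card S = DIM('a)"
    using basis_exists[of "UNIV :: 'b set"] dim by metis
  \<comment> \<open>An infinite \<open>S\<close> would have \<open>card S = 0\<close>.\<close>
  have fin: "finite S" using S(3) DIM_positive by (metis card.infinite less_irrefl)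
  have "y \<in> range f" for y
  proof (rule ccontr)
    assume y: "y \<notin> range f"
    have "span (f ` Basis) = range f" using f(1) by (simp add: linear_span_image)
    then have "independent (insert y (f ` Basis))" "y \<notin> f ` Basis"
      using y ind by (auto simp: independent_insert)
    then have "card (insert y (f ` Basis)) \<le> card S"
      using independent_span_bound[OF fin] S(2) by blast
    then show False using \<open>y \<notin> f ` Basis\<close> S(3) \<open>card (f ` Basis) = DIM('a)\<close> by simp
  qed
  then show ?thesis using f(2) by (auto simp: bij_def)
qed

text \<open>Reduces every isomorphism with a listed algebra to naming vectors \<open>v1\<close>,
  ..., \<open>v5\<close> that satisfy its ten bracket relations. The map \<open>F\<close> goes from
  the table to \<open>B\<close> and is inverted at the end.\<close>

lemma lie_isomorphic_table_bracketI:
  fixes B :: "'b::euclidean_space \<Rightarrow> 'b \<Rightarrow> 'b" and T :: "(5 \<times> 5 \<times> (real^5)) list"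
  assumes B: "bilinear B" "\<And>x. B x x = 0" and dim: "DIM('b) = 5"
    and indep: "\<And>a b c d e. a *\<^sub>R v1 + b *\<^sub>R v2 + c *\<^sub>R v3 + d *\<^sub>R v4 + e *\<^sub>R v5 = 0 \<Longrightarrow>
       a = 0 \<and> b = 0 \<and> c = 0 \<and> d = 0 \<and> e = 0"
    and F: "F = (\<lambda>x. x $ 1 *\<^sub>R v1 + x $ 2 *\<^sub>R v2 + x $ 3 *\<^sub>R v3 + x $ 4 *\<^sub>R v4 + x $ (5::5) *\<^sub>R v5)"
    and eqs: "F (table_bracket T (\<ee> 1) (\<ee> 2)) = B v1 v2" "F (table_bracket T (\<ee> 1) (\<ee> 3)) = B v1 v3"
      "F (table_bracket T (\<ee> 1) (\<ee> 4)) = B v1 v4" "F (table_bracket T (\<ee> 1) (\<ee> 5)) = B v1 v5"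
      "F (table_bracket T (\<ee> 2) (\<ee> 3)) = B v2 v3" "F (table_bracket T (\<ee> 2) (\<ee> 4)) = B v2 v4"
      "F (table_bracket T (\<ee> 2) (\<ee> 5)) = B v2 v5" "F (table_bracket T (\<ee> 3) (\<ee> 4)) = B v3 v4"
      "F (table_bracket T (\<ee> 3) (\<ee> 5)) = B v3 v5" "F (table_bracket T (\<ee> 4) (\<ee> 5)) = B v4 v5"
  shows "lie_isomorphic B (table_bracket T)"
proof -
  have lF: "linear F" unfolding F by (rule linearI) (simp_all add: algebra_simps)
  have Fax: "F (\<ee> 1) = v1" "F (\<ee> 2) = v2" "F (\<ee> 3) = v3" "F (\<ee> 4) = v4" "F (\<ee> 5) = v5"
    unfolding F by (simp_all add: axis_def)
  have sw: "B x y = - B y x" "table_bracket T p q = - table_bracket T q p" for x y p q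
    using bilinear_alternating_swap B bilinear_table_bracket table_bracket_self by blast+
  have "F (table_bracket T (\<ee> i) (\<ee> j)) = B (F (\<ee> i)) (F (\<ee> j))" for i j :: 5
  proof -
    have "\<forall>i j :: 5. F (table_bracket T (\<ee> i) (\<ee> j)) = B (F (\<ee> i)) (F (\<ee> j))"
      unfolding forall_5 Fax using eqs
      by (auto simp: table_bracket_self B linear_0[OF lF] sw(1)[of v2 v1] sw(1)[of v3 v1] sw(1)[of v4 v1] sw(1)[of v5 v1]
          sw(1)[of v3 v2] sw(1)[of v4 v2] sw(1)[of v5 v2] sw(1)[of v4 v3] sw(1)[of v5 v3] sw(1)[of v5 v4]
          sw(2)[of "\<ee> 2" "\<ee> 1"] sw(2)[of "\<ee> 3" "\<ee> 1"] sw(2)[of "\<ee> 4" "\<ee> 1"] sw(2)[of "\<ee> 5" "\<ee> 1"]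
          sw(2)[of "\<ee> 3" "\<ee> 2"] sw(2)[of "\<ee> 4" "\<ee> 2"] sw(2)[of "\<ee> 5" "\<ee> 2"]
          sw(2)[of "\<ee> 4" "\<ee> 3"] sw(2)[of "\<ee> 5" "\<ee> 3"] sw(2)[of "\<ee> 5" "\<ee> 4"] linear_neg[OF lF])
    then show ?thesis by blast
  qed
  moreover have "bilinear (\<lambda>x y. F (table_bracket T x y))"
    using bilinear_pull[OF linear_id bilinear_table_bracket lF] by simp
  moreover have "bilinear (\<lambda>x y. B (F x) (F y))"
    using bilinear_pull[OF lF B(1) linear_id] by simp
  ultimately have hom: "(\<lambda>x y. F (table_bracket T x y)) = (\<lambda>x y. B (F x) (F y))"
    by (intro ext) (rule bilinear_eq_stdbasis[THEN fun_cong, THEN fun_cong], auto simp: Basis_vec_def)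
  have "inj F"
    using indep unfolding linear_injective_0[OF lF]
    by (auto simp: F vec_eq_iff forall_5)
  then have "bij F" using lF dim by (intro bij_of_inj_linear) auto
  then show ?thesis
    using hom by (intro lie_isomorphic_sym[OF lie_isomorphicI[OF lF]]) (auto dest: fun_cong)
qed

section \<open>Normal forms of the extensions\<close>

definition J4 :: "real^4 \<Rightarrow> real^4" where
  "J4 x = vec4 (- x $ 2) (x $ 1) (- x $ 4) (x $ 3)"

definition rot4 :: "real \<Rightarrow> real \<Rightarrow> real^4 \<Rightarrow> real^4" where
  "rot4 p q x = vec4 (- p * x $ 2) (p * x $ 1) (- q * x $ 4) (q * x $ 3)"

text \<open>The entries (2,3), (3,1), (1,2) list the columns of the symmetric matrix
  \<open>L\<close> of the overview and the entries (4,j) those of \<open>A = ad e4\<close>;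
  \<open>s\<close> and \<open>b\<close> are the two free parameters of \<open>A\<close>.\<close>

definition normal_bracket :: "real \<Rightarrow> real \<Rightarrow> real \<Rightarrow> real \<Rightarrow> real \<Rightarrow> real \<Rightarrow> real \<Rightarrow> real^4 \<Rightarrow> real^4 \<Rightarrow> real^4" where
  "normal_bracket l1 l2 u1 u2 c s b = table_bracket
     [(2, 3, vec4 l1 0 u1 0), (3, 1, vec4 0 l2 u2 0), (1, 2, vec4 u1 u2 c 0),
      (4, 1, vec4 ((l1 - l2 - c) / 2) b u1 0), (4, 2, vec4 (- b) ((l2 - l1 - c) / 2) u2 0),
      (4, 3, vec4 u1 u2 ((c - l1 - l2) / 2 + s) 0)]"

lemma linear_rot4: "linear (rot4 p q)"
  by (rule linearI) (simp_all add: rot4_def algebra_simps)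

lemma linear_J4: "linear J4"
  by (rule linearI) (simp_all add: J4_def)

lemma bilinear_ext_bracket:
  assumes "bilinear C" "linear D"
  shows "bilinear (ext_bracket C D)"
  unfolding bilinear_def
  by (auto intro!: linearI simp: ext_bracket_def linear_add[OF assms(2)] linear_scale[OF assms(2)]
      bilinear_ladd[OF assms(1)] bilinear_radd[OF assms(1)] bilinear_lmul[OF assms(1)] bilinear_rmul[OF assms(1)]
      algebra_simps scaleR_add_right)

lemma ext_bracket_self: "(\<And>x. C x x = 0) \<Longrightarrow> ext_bracket C D x x = 0"
  by (cases x) (simp add: ext_bracket_def zero_prod_def)

lemma bilinear_normal_bracket: "bilinear (normal_bracket l1 l2 u1 u2 c s b)"
  unfolding normal_bracket_def by (rule bilinear_table_bracket)

lemma normal_bracket_self: "normal_bracket l1 l2 u1 u2 c s b x x = 0"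
  unfolding normal_bracket_def by (rule table_bracket_self)

lemma bilinear_abelian4: "bilinear abelian4" and abelian4_self: "abelian4 x x = 0"
  unfolding abelian4_def by (rule bilinear_table_bracket table_bracket_self)+

section \<open>Matching the non-flat normal forms with the listed algebras\<close>

lemmas ext_iso_table = lie_isomorphic_table_bracketI[OF bilinear_ext_bracket[OF bilinear_normal_bracket linear_rot4]
   ext_bracket_self[OF normal_bracket_self], simplified, OF _ refl]

lemmas abelian_ext_iso_table = lie_isomorphic_table_bracketI[OF bilinear_ext_bracket[OF bilinear_abelian4 linear_rot4]
   ext_bracket_self[OF abelian4_self], simplified, OF _ refl]

lemmas table_simps = ext_bracket_def normal_bracket_def rot4_def table_bracket_def abelian4_def axis_def zero_prod_def

text \<open>Both \<open>e4\<close> and \<open>\<xi>\<close> rotate the \<open>e1\<close>,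
  \<open>e2\<close>-plane, with speeds \<open>b\<close> and \<open>d\<close>. Since
  \<open>d \<noteq> 0\<close>, a multiple of \<open>\<xi>\<close> added to \<open>e4 / s\<close>
  cancels the rotation and leaves the identity on \<open>e3\<close>. For \<open>d = 0\<close> this
  is impossible, and the ratio of \<open>b\<close> and \<open>s\<close> becomes the parameter of
  \<open>\<gg>6_fam\<close>.\<close>

lemma iso_g1:
  assumes "s \<noteq> 0" "d \<noteq> 0"
  shows "lie_isomorphic (ext_bracket (normal_bracket 0 0 0 0 0 s b) (rot4 d 0)) \<gg>1"
  unfolding \<gg>1_def
  by (rule ext_iso_table[where ?v1.0="(- b / (d * s), vec4 0 0 0 (1/s))" and ?v2.0="(0, vec4 0 0 1 0)"
     and ?v3.0="(0, vec4 1 0 0 0)" and ?v4.0="(0, vec4 0 1 0 0)" and ?v5.0="(- 1 / d, vec4 0 0 0 0)"])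
    (use assms in \<open>auto simp: table_simps field_simps\<close>)

lemma iso_g5:
  assumes "s \<noteq> 0"
  shows "lie_isomorphic (ext_bracket (normal_bracket 0 0 0 0 0 s 0) (rot4 0 0)) \<gg>5"
  unfolding \<gg>5_def
  by (rule ext_iso_table[where ?v1.0="(0, vec4 0 0 0 (1/s))" and ?v2.0="(0, vec4 0 0 1 0)"
     and ?v3.0="(0, vec4 1 0 0 0)" and ?v4.0="(0, vec4 0 1 0 0)" and ?v5.0="(1, vec4 0 0 0 0)"])
    (use assms in \<open>auto simp: table_simps field_simps\<close>)

text \<open>Exchanging \<open>e1\<close> and \<open>e2\<close> reverses the rotation, so only the
  absolute value of \<open>b / s\<close> matters.\<close>

lemma iso_g6:
  assumes "s \<noteq> 0" "b \<noteq> 0"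
  shows "lie_isomorphic (ext_bracket (normal_bracket 0 0 0 0 0 s b) (rot4 0 0)) (\<gg>6_fam \<bar>b / s\<bar>)"
proof (cases "b / s < 0")
  case True
  have [simp]: "\<bar>b / s\<bar> = - b / s" using True by (simp only: abs_of_neg)
  show ?thesis
  unfolding \<gg>6_fam_def
  by (rule ext_iso_table[where ?v4.0="(0, vec4 0 0 0 (1/s))" and ?v1.0="(0, vec4 0 0 1 0)"
     and ?v2.0="(0, vec4 1 0 0 0)" and ?v3.0="(0, vec4 0 1 0 0)" and ?v5.0="(1, vec4 0 0 0 0)"])
    (use assms in \<open>auto simp: table_simps field_simps simp del: abs_divide\<close>)
next
  case False
  have [simp]: "\<bar>b / s\<bar> = b / s" using False by (simp only: abs_of_nonneg)
  show ?thesis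
  unfolding \<gg>6_fam_def
  by (rule ext_iso_table[where ?v4.0="(0, vec4 0 0 0 (1/s))" and ?v1.0="(0, vec4 0 0 1 0)"
     and ?v3.0="(0, vec4 1 0 0 0)" and ?v2.0="(0, vec4 0 1 0 0)" and ?v5.0="(1, vec4 0 0 0 0)"])
    (use assms in \<open>auto simp: table_simps field_simps simp del: abs_divide\<close>)
qed

text \<open>As for \<open>\<gg>1\<close>, the component of \<open>v4\<close> along
  \<open>\<xi>\<close> cancels the rotation \<open>b\<close>; the factor \<open>- 1 / c\<close>
  gives \<open>ad v4\<close> the eigenvalues 1/2, 1/2, 1 on \<open>e1\<close>, \<open>e2\<close>,
  \<open>e3\<close>.\<close>

lemma iso_g4:
  assumes "c \<noteq> 0" "d \<noteq> 0"
  shows "lie_isomorphic (ext_bracket (normal_bracket 0 0 0 0 c (- 3 * c / 2) b) (rot4 d 0)) \<gg>4"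
  unfolding \<gg>4_def
  by (rule ext_iso_table[where ?v1.0="(0, vec4 1 0 0 0)" and ?v2.0="(0, vec4 0 1 0 0)"
     and ?v3.0="(0, vec4 0 0 c 0)" and ?v4.0="(b / (c * d), vec4 0 0 0 (- 1 / c))" and ?v5.0="(- 1 / d, vec4 0 0 0 0)"])
    (use assms in \<open>auto simp: table_simps field_simps\<close>)

lemma iso_g7:
  assumes "c \<noteq> 0"
  shows "lie_isomorphic (ext_bracket (normal_bracket 0 0 0 0 c (- 3 * c / 2) 0) (rot4 0 0)) \<gg>7"
  unfolding \<gg>7_def
  by (rule ext_iso_table[where ?v1.0="(0, vec4 1 0 0 0)" and ?v2.0="(0, vec4 0 1 0 0)"
     and ?v3.0="(0, vec4 0 0 c 0)" and ?v4.0="(0, vec4 0 0 0 (- 1 / c))" and ?v5.0="(1, vec4 0 0 0 0)"])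
    (use assms in \<open>auto simp: table_simps field_simps\<close>)

text \<open>Without \<open>\<xi>\<close> to cancel it, the rotation is scaled to speed one, which
  leaves the eigenvalue \<open>\<bar>c / b\<bar>\<close> on \<open>e3\<close>. Exchanging
  \<open>e1\<close> and \<open>e2\<close> takes care of the sign and also changes the sign of
  \<open>v3\<close>.\<close>

lemma iso_g8:
  assumes "c \<noteq> 0" "b \<noteq> 0"
  shows "lie_isomorphic (ext_bracket (normal_bracket 0 0 0 0 c (- 3 * c / 2) b) (rot4 0 0)) (\<gg>8_fam \<bar>c / b\<bar>)"
proof (cases "c / b < 0")
  case True
  have [simp]: "\<bar>c / b\<bar> = - c / b" using True by (simp only: abs_of_neg)
  show ?thesis
  unfolding \<gg>8_fam_def
  by (rule ext_iso_table[where ?v4.0="(0, vec4 0 0 0 (1/b))" and ?v1.0="(0, vec4 0 1 0 0)"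
     and ?v2.0="(0, vec4 1 0 0 0)" and ?v3.0="(0, vec4 0 0 (- c) 0)" and ?v5.0="(1, vec4 0 0 0 0)"])
    (use assms in \<open>auto simp: table_simps field_simps simp del: abs_divide\<close>)
next
  case False
  have [simp]: "\<bar>c / b\<bar> = c / b" using False by (simp only: abs_of_nonneg)
  show ?thesis
  unfolding \<gg>8_fam_def
  by (rule ext_iso_table[where ?v4.0="(0, vec4 0 0 0 (- 1/b))" and ?v1.0="(0, vec4 1 0 0 0)"
     and ?v2.0="(0, vec4 0 1 0 0)" and ?v3.0="(0, vec4 0 0 c 0)" and ?v5.0="(1, vec4 0 0 0 0)"])
    (use assms in \<open>auto simp: table_simps field_simps simp del: abs_divide\<close>)
qed

lemma iso_g3:
  assumes "l \<noteq> 0"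
  shows "lie_isomorphic (ext_bracket (normal_bracket l 0 0 0 0 (3 * l / 2) 0) (rot4 0 0)) \<gg>3"
  unfolding \<gg>3_def
  by (rule ext_iso_table[where ?v1.0="(0, vec4 0 0 1 0)" and ?v2.0="(0, vec4 0 1 0 0)"
     and ?v3.0="(0, vec4 (- l) 0 0 0)" and ?v4.0="(0, vec4 0 0 0 (2 / l))" and ?v5.0="(1, vec4 0 0 0 0)"])
    (use assms in \<open>auto simp: table_simps field_simps\<close>)

text \<open>\<open>\<real>e\<^sub>1 + \<real>e\<^sub>3\<close> is an abelian ideal on which \<open>ad e\<^sub>2\<close> has the eigenvalues \<open>n\<close>, \<open>- n\<close> with eigenvectors
  \<open>(l, u + n)\<close>, \<open>(l, u - n)\<close>, and \<open>(l / n\<^sup>2) e\<^sub>4 - (u / n\<^sup>2) e\<^sub>2\<close> acts on it as the identity.\<close>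

lemma iso_g2:
  assumes "l \<noteq> 0" "s * l = 2 * (l\<^sup>2 + u\<^sup>2)"
  shows "lie_isomorphic (ext_bracket (normal_bracket l 0 u 0 (- l) s 0) (rot4 0 0)) \<gg>2"
proof -
  define n p where "n = sqrt (l\<^sup>2 + u\<^sup>2)" and "p = 1 / (2 * n)"
  have n2: "n\<^sup>2 = l\<^sup>2 + u\<^sup>2" by (simp add: n_def)
  have n: "n > 0" using assms(1) by (simp add: n_def sum_power2_gt_zero_iff)
  have p: "2 * n * p = 1" using n by (simp add: p_def)
  then have p0: "p \<noteq> 0" by auto
  \<comment> \<open>\<open>v1\<close> and \<open>v3\<close> are half the sum and half the difference
    of \<open>(l / n\<^sup>2) e4 - (u / n\<^sup>2) e2\<close>, which acts as the identity, and
    \<open>e2 / n\<close>, which acts with eigenvalues 1 and -1. Thus they act as the projections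
    onto the two eigenlines, spanned by \<open>v2\<close> and \<open>v4\<close>. Here
    \<open>p = 1 / (2 n)\<close>, \<open>q = u / (2 n\<^sup>2)\<close>,
    \<open>k = l / (2 n\<^sup>2)\<close>.\<close>
  define q k where "q = 2 * u * p\<^sup>2" and "k = 2 * l * p\<^sup>2"
  have k0: "k \<noteq> 0" using p0 assms by (simp add: k_def)
  have eqs: "(p - q) * (- l * u + (u + n) * l) + k * (l * l + (u + n) * u) = l"
    "(p - q) * (l * l + (u + n) * u) + k * (l * u + (u + n) * (s - l)) = u + n"
    "(- p - q) * (- l * u + (u - n) * l) + k * (l * l + (u - n) * u) = l"
    "(- p - q) * (l * l + (u - n) * u) + k * (l * u + (u - n) * (s - l)) = u - n"
    "(p - q) * (- l * u + (u - n) * l) + k * (l * l + (u - n) * u) = 0"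
    "(p - q) * (l * l + (u - n) * u) + k * (l * u + (u - n) * (s - l)) = 0"
    "(- p - q) * (- l * u + (u + n) * l) + k * (l * l + (u + n) * u) = 0"
    "(- p - q) * (l * l + (u + n) * u) + k * (l * u + (u + n) * (s - l)) = 0"
    using n2 p assms(2) unfolding q_def k_def power2_eq_square by algebra+
  show ?thesis
    unfolding \<gg>2_def
  proof (rule ext_iso_table[where ?v1.0="(0, vec4 0 (p - q) 0 k)" and ?v2.0="(0, vec4 l 0 (u + n) 0)"
     and ?v3.0="(0, vec4 0 (- p - q) 0 k)" and ?v4.0="(0, vec4 l 0 (u - n) 0)" and ?v5.0="(1, vec4 0 0 0 0)"])
    fix a b c d e :: real
    assume "a *\<^sub>R (0, vec4 0 (p - q) 0 k) + b *\<^sub>R (0, vec4 l 0 (u + n) 0) + c *\<^sub>R (0, vec4 0 (- p - q) 0 k) +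
       d *\<^sub>R (0, vec4 l 0 (u - n) 0) + e *\<^sub>R (1, vec4 0 0 0 0) = (0 :: real \<times> (real^4))"
    then have *: "e = 0" "b * l + d * l = 0" "a * (p - q) + c * (- p - q) = 0" "b * (u + n) + d * (u - n) = 0"
       "a * k + c * k = 0" by (auto simp: zero_prod_def)
    then have "d = - b" "c = - a" using assms(1) k0 by (auto simp: eq_neg_iff_add_eq_0 add.commute simp flip: distrib_right)
    then show "a = 0 \<and> b = 0 \<and> c = 0 \<and> d = 0 \<and> e = 0" using * n p0 by (auto simp: algebra_simps)
  qed (use eqs in \<open>simp_all add: table_simps algebra_simps\<close>)
qed

section \<open>The flat normal forms\<close>

lemma ext_inner_inner: "ext_inner (\<bullet>) = ((\<bullet>) :: real \<times> 'a::real_inner \<Rightarrow> _)"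
  by (intro ext) (simp add: ext_inner_def split: prod.splits)

lemma inner_product_inner: "inner_product ((\<bullet>) :: 'a::real_inner \<Rightarrow> _)"
  unfolding inner_product_def bilinear_def
  by (auto intro!: linearI simp: inner_commute inner_add_left inner_add_right)

lemma flat_normal:
  "flat_metric (ext_bracket (normal_bracket l l 0 0 0 l b) (rot4 d 0)) (ext_inner (\<bullet>))"
  unfolding ext_inner_inner
proof (rule flat_metricI[where R = "\<lambda>x. (0, rot4 1 0 (snd x))" and l = "\<lambda>x. d * fst x + l * snd x $ 3 + b * snd x $ 4"])
  show "linear (\<lambda>x::real \<times> (real^4). (0::real, rot4 1 0 (snd x)))"
    by (rule linearI) (simp_all add: linear_add[OF linear_rot4] linear_scale[OF linear_rot4])
  show "linear (\<lambda>x. d * fst x + l * snd x $ 3 + b * snd x $ 4)"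
    by (rule linearI) (simp_all add: algebra_simps)
  show "(0, rot4 1 0 (snd x)) \<bullet> y = - (x \<bullet> (0, rot4 1 0 (snd y)))" for x y :: "real \<times> (real^4)"
    by (cases x; cases y) (simp add: rot4_def inner_vec4)
  show "ext_bracket (normal_bracket l l 0 0 0 l b) (rot4 d 0) x y =
           (d * fst x + l * snd x $ 3 + b * snd x $ 4) *\<^sub>R (0, rot4 1 0 (snd y)) -
           (d * fst y + l * snd y $ 3 + b * snd y $ 4) *\<^sub>R (0, rot4 1 0 (snd x))" for x y
    by (cases x; cases y) (simp add: table_simps algebra_simps)
qed (simp_all add: rot4_def inner_product_inner)

lemma flat_abelian4:
  "flat_metric (ext_bracket abelian4 (rot4 p q)) (ext_inner (\<bullet>))"
  unfolding ext_inner_inner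
proof (rule flat_metricI[where R = "\<lambda>x. (0, rot4 p q (snd x))" and l = fst])
  show "linear (\<lambda>x::real \<times> (real^4). (0::real, rot4 p q (snd x)))"
    by (rule linearI) (simp_all add: linear_add[OF linear_rot4] linear_scale[OF linear_rot4])
  show "(0, rot4 p q (snd x)) \<bullet> y = - (x \<bullet> (0, rot4 p q (snd y)))" for x y :: "real \<times> (real^4)"
    by (cases x; cases y) (simp add: rot4_def inner_vec4)
  show "ext_bracket abelian4 (rot4 p q) x y = fst x *\<^sub>R (0, rot4 p q (snd y)) - fst y *\<^sub>R (0, rot4 p q (snd x))" for x y
    by (cases x; cases y) (simp add: table_simps algebra_simps)
qed (simp_all add: inner_product_inner linear_fst)

lemma normal_bracket_zero: "normal_bracket 0 0 0 0 0 0 0 = abelian4"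
  by (intro ext) (simp add: normal_bracket_def abelian4_def table_bracket_def zero_vec4)

text \<open>\<open>\<xi>\<close>, \<open>e3\<close> and \<open>e4\<close> act on the
  \<open>e1\<close>, \<open>e2\<close>-plane by \<open>d\<close>, \<open>l\<close> and
  \<open>b\<close> times the same rotation. Whichever of \<open>e3\<close>, \<open>e4\<close> acts
  non-trivially is scaled to speed -1 and taken as \<open>v5\<close>; \<open>v3\<close> and
  \<open>v4\<close> span the combinations that act trivially.\<close>

lemma iso_g1_fam_0:
  assumes "l \<noteq> 0 \<or> b \<noteq> 0"
  shows "lie_isomorphic (ext_bracket (normal_bracket l l 0 0 0 l b) (rot4 d 0)) (\<gg>1_fam 0)"
proof (cases "b = 0")
  case True
  then have "l \<noteq> 0" using assms by simp
  then show ?thesis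
    unfolding \<gg>1_fam_def True
    by (intro ext_iso_table[where ?v1.0="(0, vec4 1 0 0 0)" and ?v2.0="(0, vec4 0 1 0 0)"
     and ?v3.0="(0, vec4 0 0 0 1)" and ?v4.0="(1, vec4 0 0 (- d / l) 0)" and ?v5.0="(0, vec4 0 0 (- 1 / l) 0)"])
    (auto simp: table_simps field_simps)
next
  case False
  then show ?thesis
    unfolding \<gg>1_fam_def
    by (intro ext_iso_table[where ?v1.0="(0, vec4 1 0 0 0)" and ?v2.0="(0, vec4 0 1 0 0)"
     and ?v3.0="(0, vec4 0 0 1 (- l / b))" and ?v4.0="(1, vec4 0 0 0 (- d / b))" and ?v5.0="(0, vec4 0 0 0 (- 1 / b))"])
    (auto simp: table_simps field_simps)
qed

lemma iso_rr'_3_0: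
  assumes "l \<noteq> 0 \<or> b \<noteq> 0"
  shows "lie_isomorphic (normal_bracket l l 0 0 0 l b) rr'_3_0"
proof -
  define n where "n = l\<^sup>2 + b\<^sup>2"
  have n: "n \<noteq> 0" using assms by (simp add: n_def sum_power2_eq_zero_iff)
  \<comment> \<open>The image \<open>- (l e3 + b e4) / n\<close> of \<open>e1\<close> rotates the
    plane with speed -1, as \<open>e1\<close> does in \<open>rr'_3_0\<close>; the image
    \<open>- b e3 + l e4\<close> of \<open>e4\<close> acts trivially.\<close>
  define f where "f x = vec4 (x $ 2) (x $ 3) (- l / n * x $ 1 - b * x $ 4) (- b / n * x $ 1 + l * x $ 4)" for x :: "real^4"
  have lf: "linear f" by (rule linearI) (simp_all add: f_def algebra_simps)
  have "inj f"
    unfolding linear_injective_0[OF lf]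
  proof (intro allI impI)
    fix x assume "f x = 0"
    then have *: "x $ 2 = 0" "x $ 3 = 0" "- l / n * x $ 1 - b * x $ 4 = 0" "- b / n * x $ 1 + l * x $ 4 = 0"
      by (auto simp: f_def)
    have e: "l * n * x $ 4 = b * x $ 1" "b * n * x $ 4 = - (l * x $ 1)" using *(3,4) n by (auto simp: field_simps)
    have "n * x $ 1 = 0" "n * n * x $ 4 = 0" using e unfolding n_def power2_eq_square by algebra+
    then show "x = 0" using n * by (auto intro: vec4_eqI)
  qed
  then have "bij f" using lf by (intro bij_of_inj_linear) auto
  moreover have "f (rr'_3_0 x y) = normal_bracket l l 0 0 0 l b (f x) (f y)" for x y
  proof -
    have r: "l * (l / n) + b * (b / n) = 1" using n by (simp add: n_def power2_eq_square flip: add_divide_distrib)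
    show ?thesis
    apply (simp add: f_def rr'_3_0_def normal_bracket_def table_bracket_def axis_def algebra_simps)
    using r
    apply algebra
    done
  qed
  ultimately show ?thesis using lf by (intro lie_isomorphic_sym[OF lie_isomorphicI[of f]])
qed

lemma iso_g1_fam:
  assumes "p \<noteq> 0"
  shows "lie_isomorphic (ext_bracket abelian4 (rot4 p q)) (\<gg>1_fam (q / p))"
  unfolding \<gg>1_fam_def
  by (rule abelian_ext_iso_table[where ?v1.0="(0, vec4 1 0 0 0)" and ?v2.0="(0, vec4 0 1 0 0)"
    and ?v3.0="(0, vec4 0 0 1 0)" and ?v4.0="(0, vec4 0 0 0 1)" and ?v5.0="(- 1 / p, vec4 0 0 0 0)"])
  (use assms in \<open>auto simp: table_simps field_simps\<close>)

lemma iso_abelian_ext_swap: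
  "lie_isomorphic (ext_bracket abelian4 (rot4 p q)) (ext_bracket abelian4 (rot4 q p))"
proof (rule lie_isomorphicI[of "\<lambda>(s, x). (s, vec4 (x $ 3) (x $ 4) (x $ 1) (x $ 2))"])
  show "linear (\<lambda>(s::real, x::real^4). (s, vec4 (x $ 3) (x $ 4) (x $ 1) (x $ 2)))"
    by (rule linearI) auto
  show "bij (\<lambda>(s::real, x::real^4). (s, vec4 (x $ 3) (x $ 4) (x $ 1) (x $ 2)))"
    by (rule involuntory_imp_bij) (auto intro: vec4_eqI)
qed (auto simp: table_simps)

lemma iso_abelian_ext_neg:
  "lie_isomorphic (ext_bracket abelian4 (rot4 p q)) (ext_bracket abelian4 (rot4 p (- q)))"
proof (rule lie_isomorphicI[of "\<lambda>(s, x). (s, vec4 (x $ 1) (x $ 2) (x $ 4) (x $ 3))"])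
  show "linear (\<lambda>(s::real, x::real^4). (s, vec4 (x $ 1) (x $ 2) (x $ 4) (x $ 3)))"
    by (rule linearI) auto
  show "bij (\<lambda>(s::real, x::real^4). (s, vec4 (x $ 1) (x $ 2) (x $ 4) (x $ 3)))"
    by (rule involuntory_imp_bij) (auto intro: vec4_eqI)
qed (auto simp: table_simps)

text \<open>Exchanging the two planes inverts \<open>q / p\<close>, and exchanging two basis vectors
  of one plane changes its sign. The interval [0, 1] contains a representative of every
  ratio.\<close>

lemma iso_first_family:
  assumes "p \<noteq> 0 \<or> q \<noteq> 0"
  shows "\<exists>M \<in> first_family. lie_isomorphic (ext_bracket abelian4 (rot4 p q)) M"
proof -
  have *: "\<exists>M \<in> first_family. lie_isomorphic (ext_bracket abelian4 (rot4 p q)) M"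
    if "p \<noteq> 0" "\<bar>q\<bar> \<le> \<bar>p\<bar>" for p q
  proof (cases "q / p < 0")
    case True
    have "\<gg>1_fam (- q / p) \<in> first_family"
      using that True unfolding first_family_def by (auto simp: field_simps abs_if split: if_splits)
    then show ?thesis
      using lie_isomorphic_trans[OF iso_abelian_ext_neg iso_g1_fam[OF that(1), of "- q"]] by blast
  next
    case False
    have "\<gg>1_fam (q / p) \<in> first_family"
      using that False unfolding first_family_def by (auto simp: field_simps abs_if split: if_splits)
    then show ?thesis using iso_g1_fam[OF that(1)] by blast
  qed
  show ?thesis
  proof (cases "\<bar>q\<bar> \<le> \<bar>p\<bar>")
    case True
    then show ?thesis using assms by (intro *) auto
  next
    case False
    then obtain M where "M \<in> first_family" "lie_isomorphic (ext_bracket abelian4 (rot4 q p)) M"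
      using *[of q p] by fastforce
    then show ?thesis using lie_isomorphic_trans[OF iso_abelian_ext_swap] by blast
  qed
qed

section \<open>Kaehler structures realizing the listed algebras\<close>

lemma inner_J4: "J4 x \<bullet> J4 y = x \<bullet> y"
  by (simp add: J4_def inner_vec4)

lemma J4_J4: "J4 (J4 x) = - x"
  by (rule vec4_eqI) (simp_all add: J4_def)

lemma extension_data_tableI:
  assumes jac: "\<And>x y z. table_bracket T x (table_bracket T y z) + table_bracket T y (table_bracket T z x) +
     table_bracket T z (table_bracket T x y) = 0"
    and "\<And>x y. nijenhuis (table_bracket T) J4 x y = 0"
    and "\<And>x y z. ce_d2 (table_bracket T) (\<lambda>x y. J4 x \<bullet> y) x y z = 0"
    and "\<And>x y. rot4 p q (table_bracket T x y) = table_bracket T (rot4 p q x) y + table_bracket T x (rot4 p q y)"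
  shows "extension_data (table_bracket T) J4 (\<bullet>) (rot4 p q)"
  unfolding extension_data_def kaehler_def lie_algebra_def lie_derivation_def
  using assms
  by (simp add: bilinear_table_bracket table_bracket_self linear_J4 inner_product_inner J4_J4 inner_J4 linear_rot4)
    (simp add: rot4_def J4_def inner_vec4)

lemmas table4_simps = nijenhuis_def ce_d2_def rot4_def J4_def table_bracket_def abelian4_def axis_def zero_vec4 inner_vec4

lemma extension_data_abelian4: "extension_data abelian4 J4 (\<bullet>) (rot4 p q)"
  unfolding abelian4_def
  by (rule extension_data_tableI) (simp_all add: table4_simps)

lemma extension_data_r'4: "extension_data (normal_bracket 0 0 0 0 0 s b) J4 (\<bullet>) (rot4 d 0)"
  unfolding normal_bracket_def
  by (rule extension_data_tableI) (simp_all add: table4_simps algebra_simps)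

lemma extension_data_d4: "extension_data (normal_bracket 0 0 0 0 c (- 3 * c / 2) b) J4 (\<bullet>) (rot4 d 0)"
  unfolding normal_bracket_def
  by (rule extension_data_tableI) (simp_all add: table4_simps algebra_simps)

lemma extension_data_d42: "extension_data (normal_bracket l 0 0 0 0 (3 * l / 2) 0) J4 (\<bullet>) (rot4 0 0)"
  unfolding normal_bracket_def
  by (rule extension_data_tableI) (simp_all add: table4_simps algebra_simps)

lemma extension_data_r2r2: "extension_data (normal_bracket l 0 0 0 (- l) (2 * l) 0) J4 (\<bullet>) (rot4 0 0)"
  unfolding normal_bracket_def
  by (rule extension_data_tableI) (simp_all add: table4_simps algebra_simps)

text \<open>The complex structure preserves the plane of \<open>e2\<close> and \<open>e3\<close>,
  which \<open>e1\<close> rotates, and pairs \<open>e1\<close> with the central vector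
  \<open>e4\<close>; so it differs from \<open>J4\<close>.\<close>

lemma extension_data_rr'_3_0:
  "extension_data rr'_3_0 (\<lambda>x. vec4 (- x $ 4) (- x $ 3) (x $ 2) (x $ 1)) (\<bullet>) (\<lambda>x. 0)"
  unfolding extension_data_def kaehler_def lie_algebra_def lie_derivation_def rr'_3_0_def
  by (auto simp: bilinear_table_bracket table_bracket_self inner_product_inner linear_zero intro!: linearI vec4_eqI)
   (simp_all add: table4_simps algebra_simps)

lemma flat_rr'_3_0: "flat_metric (ext_bracket rr'_3_0 (\<lambda>x. 0)) (ext_inner (\<bullet>))"
  unfolding ext_inner_inner
proof (rule flat_metricI[where R = "\<lambda>x. (0, vec4 0 (snd x $ 3) (- snd x $ 2) 0)" and l = "\<lambda>x. snd x $ 1"])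
  show "linear (\<lambda>x::real \<times> (real^4). (0::real, vec4 0 (snd x $ 3) (- snd x $ 2) 0))"
    by (rule linearI) simp_all
  show "linear (\<lambda>x::real \<times> (real^4). snd x $ 1)"
    by (rule linearI) simp_all
  show "(0, vec4 0 (snd x $ 3) (- snd x $ 2) 0) \<bullet> y = - (x \<bullet> (0, vec4 0 (snd y $ 3) (- snd y $ 2) 0))" for x y :: "real \<times> (real^4)"
    by (cases x; cases y) (simp add: inner_vec4)
  show "ext_bracket rr'_3_0 (\<lambda>x. 0) x y = snd x $ 1 *\<^sub>R (0, vec4 0 (snd y $ 3) (- snd y $ 2) 0) -
     snd y $ 1 *\<^sub>R (0, vec4 0 (snd x $ 3) (- snd x $ 2) 0)" for x y
    by (cases x; cases y) (auto simp: table_simps rr'_3_0_def algebra_simps intro!: vec4_eqI)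
qed (simp_all add: inner_product_inner)

section \<open>Presence and absence of ad-eigenvectors\<close>

lemma not_has_ad_eigenvector_abelian4: "\<not> has_ad_eigenvector abelian4"
  by (simp add: has_ad_eigenvector_def abelian4_def table_bracket_def)

lemma has_ad_eigenvector_ext:
  assumes "has_ad_eigenvector C" "linear D"
  shows "has_ad_eigenvector (ext_bracket C D)"
proof -
  obtain x y where "y \<noteq> 0" "C x y = y" using assms unfolding has_ad_eigenvector_def by blast
  then have "(0, y) \<noteq> 0" "ext_bracket C D (0, x) (0, y) = (0, y)"
    by (simp_all add: ext_bracket_def zero_prod_def)
  then show ?thesis unfolding has_ad_eigenvector_def by blast
qed

text \<open>An eigenvector would survive in the extension by \<open>D = 0\<close>, which is
  flat.\<close>

lemma not_has_ad_eigenvector_rr'_3_0: "\<not> has_ad_eigenvector rr'_3_0"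
proof
  assume "has_ad_eigenvector rr'_3_0"
  then have "has_ad_eigenvector (ext_bracket rr'_3_0 (\<lambda>x. 0))"
    by (rule has_ad_eigenvector_ext) (rule linear_zero)
  then show False using flat_metric_no_ad_eigenvector flat_rr'_3_0 by (auto simp: ext_inner_inner)
qed

lemma has_ad_eigenvectorI: "y \<noteq> 0 \<Longrightarrow> B x y = y \<Longrightarrow> has_ad_eigenvector B"
  unfolding has_ad_eigenvector_def by blast

lemma has_ad_eigenvector_normal:
  "s \<noteq> 0 \<Longrightarrow> has_ad_eigenvector (normal_bracket 0 0 0 0 0 s b)"
  "c \<noteq> 0 \<Longrightarrow> has_ad_eigenvector (normal_bracket 0 0 0 0 c (- 3 * c / 2) b)"
  "l \<noteq> 0 \<Longrightarrow> has_ad_eigenvector (normal_bracket l 0 0 0 0 (3 * l / 2) 0)"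
  subgoal by (rule has_ad_eigenvectorI[where x = "vec4 0 0 0 (1 / s)" and y = "vec4 0 0 1 0"]) (simp_all add: table_simps zero_vec4)
  subgoal by (rule has_ad_eigenvectorI[where x = "vec4 0 0 0 (- 1 / c)" and y = "vec4 0 0 1 0"]) (simp_all add: table_simps zero_vec4)
  subgoal by (rule has_ad_eigenvectorI[where x = "vec4 0 0 0 (1 / l)" and y = "vec4 0 0 1 0"]) (simp_all add: table_simps zero_vec4)
  done

lemma has_ad_eigenvector_r2r2:
  assumes "l \<noteq> 0"
  shows "has_ad_eigenvector (normal_bracket l 0 u 0 (- l) s 0)"
proof -
  define n where "n = l\<^sup>2 + u\<^sup>2"
  have "n > 0" using assms by (simp add: n_def sum_power2_gt_zero_iff)
  moreover have "u * u + l * l = n" by (simp add: n_def power2_eq_square)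
  ultimately show ?thesis
    by (intro has_ad_eigenvectorI[where x = "vec4 0 (- u / n) 0 (l / n)" and y = "vec4 1 0 0 0"])
      (auto simp: table_simps zero_vec4 simp flip: add_divide_distrib)
qed

section \<open>Kaehler Lie algebras of dimension four\<close>

abbreviation "e1 \<equiv> vec4 1 0 0 0"
abbreviation "e2 \<equiv> vec4 0 1 0 0"
abbreviation "e3 \<equiv> vec4 0 0 1 0"
abbreviation "e4 \<equiv> vec4 0 0 0 1"

lemma vec4_basis: "(x::real^4) = x $ 1 *\<^sub>R e1 + x $ 2 *\<^sub>R e2 + x $ 3 *\<^sub>R e3 + x $ 4 *\<^sub>R e4"
  by (rule vec4_eqI) simp_all

lemma linear_vec4_expand:
  assumes "linear f"
  shows "f (x::real^4) = x $ 1 *\<^sub>R f e1 + x $ 2 *\<^sub>R f e2 + x $ 3 *\<^sub>R f e3 + x $ 4 *\<^sub>R f e4"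
  by (subst vec4_basis) (simp only: linear_add[OF assms] linear_scale[OF assms])

lemma bilinear_alternating_table:
  fixes C :: "real^4 \<Rightarrow> real^4 \<Rightarrow> real^4"
  assumes C: "bilinear C" "\<And>x. C x x = 0"
  shows "C = table_bracket [(2, 3, C e2 e3), (3, 1, C e3 e1), (1, 2, C e1 e2),
     (4, 1, C e4 e1), (4, 2, C e4 e2), (4, 3, C e4 e3)]"
proof (intro ext)
  fix x y
  have l: "linear (\<lambda>x. C x y)" "linear (C x)" for x y using C(1) by (auto simp: bilinear_def)
  note sw = bilinear_alternating_swap[OF C]
  have "C x y = x $ 1 *\<^sub>R C e1 y + x $ 2 *\<^sub>R C e2 y + x $ 3 *\<^sub>R C e3 y + x $ 4 *\<^sub>R C e4 y"
    by (rule linear_vec4_expand[OF l(1)])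
  then show "C x y = table_bracket [(2, 3, C e2 e3), (3, 1, C e3 e1), (1, 2, C e1 e2),
     (4, 1, C e4 e1), (4, 2, C e4 e2), (4, 3, C e4 e3)] x y"
    unfolding linear_vec4_expand[OF l(2), of _ y] C(2) sw[of e2 e1] sw[of e1 e3] sw[of e3 e2]
      sw[of e1 e4] sw[of e2 e4] sw[of e3 e4]
    by (simp add: table_bracket_def algebra_simps)
qed

text \<open>The brackets of \<open>span {e\<^sub>1, e\<^sub>2, e\<^sub>3}\<close> are given by the symmetric matrix \<open>L\<close> with rows
  \<open>(l1, 0, u1)\<close>, \<open>(0, l2, u2)\<close>, \<open>(u1, u2, c)\<close> via \<open>[x, y] = L (x \<times> y)\<close>. The Kaehler conditions amount to
  \<open>ad e\<^sub>4 = A = L - (t/2) I + s E\<^sub>3\<^sub>3 + b R\<close> with \<open>t = tr L\<close> and the rotation \<open>R\<close> of the \<open>e\<^sub>1, e\<^sub>2\<close>-plane, and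
  the Jacobi identity amounts to \<open>A L + L A\<^sup>T = (tr A) L\<close>.\<close>

lemma kaehler_normal_form:
  assumes K: "kaehler C J4 (\<bullet>)"
    and ideal: "\<And>x y. C x y $ 4 = 0"
    and unim: "\<And>x. x $ 4 = 0 \<Longrightarrow> C x e1 $ 1 + C x e2 $ 2 + C x e3 $ 3 = 0"
    and diag: "C e2 e3 $ 2 = 0"
  obtains l1 l2 u1 u2 c s b where "C = normal_bracket l1 l2 u1 u2 c s b"
    "l1 = C e2 e3 $ 1" "l2 = C e3 e1 $ 2"
    "2 * (l1\<^sup>2 + u1\<^sup>2) = ((l1 + l2 + c) / 2 + s) * l1"
    "2 * (l2\<^sup>2 + u2\<^sup>2) = ((l1 + l2 + c) / 2 + s) * l2"
    "2 * u1 * u2 + b * (l1 - l2) = 0"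
    "2 * (l1 * u1 + u1 * c) - (l1 + l2 + c) / 2 * u1 - b * u2 = 0"
    "2 * (l2 * u2 + u2 * c) - (l1 + l2 + c) / 2 * u2 + b * u1 = 0"
    "2 * (u1\<^sup>2 + u2\<^sup>2 + c\<^sup>2) + (s - (l1 + l2 + c) / 2) * c = 0"
proof -
  have C: "bilinear C" "\<And>x. C x x = 0"
    and jac: "\<And>x y z. C x (C y z) + C y (C z x) + C z (C x y) = 0"
    and N: "\<And>x y. nijenhuis C J4 x y = 0"
    and w: "\<And>x y z. ce_d2 C (\<lambda>X Y. J4 X \<bullet> Y) x y z = 0"
    using K unfolding kaehler_def lie_algebra_def by blast+
  have v4: "\<exists>a b c. C x y = vec4 a b c 0" for x y
    using vec4_eta[of "C x y"] ideal by metis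
  obtain l1 p r1 p' l2 r2 c1 c2 c3 where
    k: "C e2 e3 = vec4 l1 p r1 0" "C e3 e1 = vec4 p' l2 r2 0" "C e1 e2 = vec4 c1 c2 c3 0"
    using v4 by metis
  obtain a11 a21 a31 a12 a22 a32 a13 a23 a33 where
    a: "C e4 e1 = vec4 a11 a21 a31 0" "C e4 e2 = vec4 a12 a22 a32 0" "C e4 e3 = vec4 a13 a23 a33 0"
    using v4 by metis
  define T where "T = [(2::4, 3::4, vec4 l1 p r1 0), (3, 1, vec4 p' l2 r2 0), (1, 2, vec4 c1 c2 c3 0),
     (4, 1, vec4 a11 a21 a31 0), (4, 2, vec4 a12 a22 a32 0), (4, 3, vec4 a13 a23 a33 0)]"
  have CT: "C = table_bracket T"
    using bilinear_alternating_table[OF C] unfolding k a T_def by simp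
  have p: "p = 0" using diag by (simp add: k)
  \<comment> \<open>Vanishing of \<open>tr ad x\<close> for \<open>x = e1, e2, e3\<close> is the
    symmetry of the matrix with columns \<open>[e2, e3]\<close>, \<open>[e3, e1]\<close>,
    \<open>[e1, e2]\<close>.\<close>
  have u: "p' = p" "c1 = r1" "c2 = r2"
    using unim[of e1] unim[of e2] unim[of e3] C(2) k bilinear_alternating_swap[OF C, of e1 e3]
      bilinear_alternating_swap[OF C, of e2 e1] bilinear_alternating_swap[OF C, of e3 e2] by auto
  have d: "a11 + a22 + c3 = 0" "a23 = r2" "a13 = r1"
    using w[of e4 e1 e2] w[of e4 e1 e3] w[of e4 e2 e3] unfolding CT T_def by (auto simp: table4_simps)
  \<comment> \<open>As \<open>J4 e1 = e2\<close> and \<open>J4 e3 = e4\<close>, the complex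
    antilinearity of the Nijenhuis tensor in each argument makes its value at
    \<open>(e1, e3)\<close> determine it.\<close>
  have n: "a31 = r1" "a32 = r2" "a12 + a21 = 2 * p" "a22 - a11 = l2 - l1"
    using N[of e1 e3] d u unfolding CT T_def by (auto simp: table4_simps)
  \<comment> \<open>The deviation of \<open>a33\<close> from the (3,3) entry of
    \<open>L - (t/2) I\<close>; neither Kaehler condition restricts it.\<close>
  define s where "s = a33 - (c3 - l1 - l2) / 2"
  have A: "a11 = (l1 - l2 - c3) / 2" "a22 = (l2 - l1 - c3) / 2" "a12 = - a21" "a33 = (c3 - l1 - l2) / 2 + s"
    using d n p by (auto simp: s_def)
  \<comment> \<open>These are the three columns of the matrix equation
    \<open>A L + L A^T = (tr A) L\<close>.\<close>
  note j = jac[of e4 e2 e3, unfolded CT T_def A p u d n] jac[of e4 e3 e1, unfolded CT T_def A p u d n]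
    jac[of e4 e1 e2, unfolded CT T_def A p u d n]
  have eqs: "2 * (l1\<^sup>2 + r1\<^sup>2) = ((l1 + l2 + c3) / 2 + s) * l1"
    "2 * (l2\<^sup>2 + r2\<^sup>2) = ((l1 + l2 + c3) / 2 + s) * l2"
    "2 * r1 * r2 + a21 * (l1 - l2) = 0"
    "2 * (l1 * r1 + r1 * c3) - (l1 + l2 + c3) / 2 * r1 - a21 * r2 = 0"
    "2 * (l2 * r2 + r2 * c3) - (l1 + l2 + c3) / 2 * r2 + a21 * r1 = 0"
    "2 * (r1\<^sup>2 + r2\<^sup>2 + c3\<^sup>2) + (s - (l1 + l2 + c3) / 2) * c3 = 0"
    using j by (simp_all add: table4_simps) (simp_all add: field_simps power2_eq_square)
  have "C = normal_bracket l1 l2 r1 r2 c3 s a21"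
    unfolding CT T_def normal_bracket_def u d n p A by simp
  then show ?thesis
    using eqs k by (intro that) simp_all
qed

text \<open>The hypotheses are the entries of the matrix equation. The order of the squares breaks
  the symmetry between \<open>e1\<close> and \<open>e2\<close>: \<open>l1 = 0\<close> forces
  \<open>l2 = 0\<close>. The five outcomes are, in order: the flat algebras; \<open>\<gg>1\<close>,
  \<open>\<gg>5\<close>, \<open>\<gg>6_fam\<close>; \<open>\<gg>4\<close>, \<open>\<gg>7\<close>,
  \<open>\<gg>8_fam\<close>; \<open>\<gg>3\<close>; \<open>\<gg>2\<close>.\<close>

lemma normal_form_cases:
  fixes l1 l2 u1 u2 c s b :: real
  assumes E: "2 * (l1\<^sup>2 + u1\<^sup>2) = ((l1 + l2 + c) / 2 + s) * l1"
    "2 * (l2\<^sup>2 + u2\<^sup>2) = ((l1 + l2 + c) / 2 + s) * l2"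
    "2 * u1 * u2 + b * (l1 - l2) = 0"
    "2 * (l1 * u1 + u1 * c) - (l1 + l2 + c) / 2 * u1 - b * u2 = 0"
    "2 * (l2 * u2 + u2 * c) - (l1 + l2 + c) / 2 * u2 + b * u1 = 0"
    "2 * (u1\<^sup>2 + u2\<^sup>2 + c\<^sup>2) + (s - (l1 + l2 + c) / 2) * c = 0"
    and ord: "l2\<^sup>2 \<le> l1\<^sup>2"
  obtains "l1 = l2" "u1 = 0" "u2 = 0" "c = 0" "s = l1"
  | "l1 = 0" "l2 = 0" "u1 = 0" "u2 = 0" "c = 0" "s \<noteq> 0"
  | "l1 = 0" "l2 = 0" "u1 = 0" "u2 = 0" "c \<noteq> 0" "s = - 3 * c / 2"
  | "l1 \<noteq> 0" "l2 = 0" "u1 = 0" "u2 = 0" "c = 0" "s = 3 * l1 / 2" "b = 0"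
  | "l1 \<noteq> 0" "l2 = 0" "u2 = 0" "c = - l1" "s * l1 = 2 * (l1\<^sup>2 + u1\<^sup>2)" "b = 0"
proof -
  \<comment> \<open>This is \<open>tr A\<close>, and the last equation reads
    \<open>2 (u1\<^sup>2 + u2\<^sup>2 + c\<^sup>2) + \<tau> c = 0\<close>.\<close>
  define \<tau> where "\<tau> = s - (l1 + l2 + c) / 2"
  consider "\<tau> = 0" | "\<tau> \<noteq> 0" "l1 = 0" | "\<tau> \<noteq> 0" "l1 \<noteq> 0" by blast
  then show ?thesis
  proof cases
    case 1
    then have "u1\<^sup>2 + u2\<^sup>2 + c\<^sup>2 = 0" using E(6) unfolding \<tau>_def[symmetric] by simp
    then have z: "u1 = 0" "u2 = 0" "c = 0"
      by (metis add_nonneg_eq_0_iff add_nonneg_nonneg zero_eq_power2 zero_le_power2)+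
    have s: "s = (l1 + l2) / 2" using 1 z by (simp add: \<tau>_def)
    have "l1 * (l1 - l2) = 0" "l2 * (l1 - l2) = 0" using E(1,2) z s by algebra+
    then have "l1 = l2" by auto
    then show ?thesis using that(1) z s by simp
  next
    case 2
    then have "l2 = 0" using ord by simp
    then have z: "l2 = 0" "u1 = 0" "u2 = 0" using E(1,2) 2 by auto
    then have "c * (2 * c + (s - c / 2)) = 0" using E(6) 2 by (simp add: power2_eq_square algebra_simps)
    then have "c = 0 \<or> 2 * c + (s - c / 2) = 0" by simp
    then have "c = 0 \<or> s = - 3 * c / 2" by auto
    then show ?thesis
      using 2 z that(2,3) by (cases "c = 0") (auto simp: \<tau>_def)
  next
    case 3
    define \<kappa> where "\<kappa> = (l1 + l2 + c) / 2 + s"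
    \<comment> \<open>The expression is \<open>det L\<close>; its product with \<open>\<tau>\<close>
      vanishes by the pairing with the adjugate of \<open>L\<close>.\<close>
    have det: "l1 * l2 * c - l1 * u2\<^sup>2 - l2 * u1\<^sup>2 = 0"
    proof -
      have "\<tau> * (l1 * l2 * c - l1 * u2\<^sup>2 - l2 * u1\<^sup>2) = 0"
        using E unfolding \<tau>_def by algebra
      then show ?thesis using 3 by simp
    qed
    have l2: "l2 = 0"
    proof (rule ccontr)
      assume l2: "l2 \<noteq> 0"
      \<comment> \<open>Replacing \<open>u1\<^sup>2\<close> and \<open>u2\<^sup>2\<close> in
        \<open>det L = 0\<close> by means of the first two equations leaves a multiple of
        \<open>l1 l2\<close>. Dividing it out gives \<open>\<kappa> = l1 + l2 + c\<close>, which
        means \<open>\<tau> = 0\<close>.\<close>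
      have "l1 * l2 * (2 * c) = l1 * l2 * (2 * \<kappa> - 2 * l1 - 2 * l2)"
        using det E(1,2) unfolding \<kappa>_def[symmetric] by algebra
      then have "2 * c = 2 * \<kappa> - 2 * l1 - 2 * l2" using l2 3 by simp
      then have "\<tau> = 0" unfolding \<kappa>_def \<tau>_def by (simp add: field_simps)
      then show False using 3 by simp
    qed
    then have u2: "u2 = 0" using E(2) by simp
    then have b: "b = 0" using E(3) 3 l2 by simp
    have e1: "2 * (l1\<^sup>2 + u1\<^sup>2) = ((l1 + c) / 2 + s) * l1"
      and e4: "u1 * (l1 + c) = 0"
      and e6: "2 * (u1\<^sup>2 + c\<^sup>2) + (s - (l1 + c) / 2) * c = 0"
      using E(1,4,6) l2 u2 b by (simp_all add: field_simps)
    consider "l1 + c = 0" | "l1 + c \<noteq> 0" "u1 = 0" using e4 by auto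
    then show ?thesis
    proof cases
      case 1
      then have "c = - l1" by simp
      then show ?thesis using that(5) 3 l2 u2 b e1 by simp
    next
      case 2
      have s: "s = 2 * l1 - (l1 + c) / 2" using e1 2 3 by (simp add: power2_eq_square)
      have "c = 0"
      proof (rule ccontr)
        assume "c \<noteq> 0"
        moreover have "c * (2 * c + (s - (l1 + c) / 2)) = 0"
          using e6 2 by (simp add: power2_eq_square algebra_simps)
        ultimately have "2 * c + (s - (l1 + c) / 2) = 0" by simp
        then show False using s 2 by simp
      qed
      then show ?thesis using that(4) 3 l2 u2 b 2 s by simp
    qed
  qed
qed

text \<open>The real form of a matrix in u(2) with respect to the complex basis \<open>e1\<close>,
  \<open>e3\<close>: \<open>p\<close> and \<open>q\<close> give the imaginary diagonal,
  \<open>x\<close> and \<open>y\<close> the off-diagonal entry.\<close>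

lemma skew_hermitian_form:
  assumes "linear D" "\<And>x y. D x \<bullet> y = - (x \<bullet> D y)" "\<And>x. D (J4 x) = J4 (D x)"
  obtains p q x y where "D e1 = vec4 0 p x y" "D e2 = vec4 (- p) 0 (- y) x"
    "D e3 = vec4 (- x) y 0 q" "D e4 = vec4 (- y) (- x) (- q) 0"
proof -
  have J: "J4 e1 = e2" "J4 e3 = e4" by (simp_all add: J4_def)
  show ?thesis
  proof (rule that[of "D e1 $ 2" "D e1 $ 3" "D e1 $ 4" "D e3 $ 4"])
    have *: "D e1 $ 1 = 0" "D e3 $ 3 = 0" "D e3 $ 1 = - D e1 $ 3" "D e3 $ 2 = D e1 $ 4"
      using assms(2)[of e1 e1] assms(2)[of e3 e3] assms(2)[of e1 e3] assms(2)[of e3 e2] assms(3)[of e1] J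
      by (auto simp: inner_vec4 J4_def)
    then show "D e1 = vec4 0 (D e1 $ 2) (D e1 $ 3) (D e1 $ 4)"
      and "D e3 = vec4 (- (D e1 $ 3)) (D e1 $ 4) 0 (D e3 $ 4)"
      by (auto intro: vec4_eqI)
    show "D e2 = vec4 (- (D e1 $ 2)) 0 (- (D e1 $ 4)) (D e1 $ 3)"
      using assms(3)[of e1] * by (simp add: J J4_def)
    show "D e4 = vec4 (- (D e1 $ 4)) (- (D e1 $ 3)) (- (D e3 $ 4)) 0"
      using assms(3)[of e3] * by (simp add: J J4_def)
  qed
qed

lemma rot4_eqI:
  assumes "linear D" "D e1 = vec4 0 p 0 0" "D e2 = vec4 (- p) 0 0 0" "D e3 = vec4 0 0 0 q" "D e4 = vec4 0 0 (- q) 0"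
  shows "D = rot4 p q"
  by (rule ext, subst linear_vec4_expand[OF assms(1)]) (simp add: assms rot4_def)


text \<open>In the second alternative \<open>has_ad_eigenvector C\<close> excludes that \<open>C\<close> is isomorphic to \<open>abelian4\<close> or \<open>rr'_3_0\<close>.\<close>

definition classified_extension ::
    "('a::real_vector \<Rightarrow> 'a \<Rightarrow> 'a) \<Rightarrow> ('a \<Rightarrow> 'a \<Rightarrow> real) \<Rightarrow> ('a \<Rightarrow> 'a) \<Rightarrow> bool" where
  "classified_extension C ip D \<longleftrightarrow>
     flat_metric (ext_bracket C D) (ext_inner ip) \<and> (lie_isomorphic C abelian4 \<or> lie_isomorphic C rr'_3_0) \<and>
       (\<exists>M \<in> first_family. lie_isomorphic (ext_bracket C D) M) \<or>
     \<not> flat_metric (ext_bracket C D) (ext_inner ip) \<and> has_ad_eigenvector C \<and>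
       (\<exists>M \<in> remaining_lines. lie_isomorphic (ext_bracket C D) M)"

lemma classified_nonflat:
  fixes C :: "'a::euclidean_space \<Rightarrow> 'a \<Rightarrow> 'a"
  assumes "has_ad_eigenvector C" "linear D" "lie_isomorphic (ext_bracket C D) M" "M \<in> remaining_lines"
  shows "classified_extension C (\<bullet>) D"
proof -
  have "\<not> flat_metric (ext_bracket C D) (ext_inner (\<bullet>))"
    using assms flat_metric_no_ad_eigenvector has_ad_eigenvector_ext unfolding ext_inner_inner by blast
  then show ?thesis using assms unfolding classified_extension_def by blast
qed

text \<open>In each family the derivation property removes from u(2) everything except a rotation of
  the \<open>e1\<close>, \<open>e2\<close>-plane, and in the last two families also this rotation.
  Whether it is present, and whether \<open>b = 0\<close>, selects the line of the list.\<close>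

lemma classified_normal_form:
  assumes E: "extension_data C J4 (\<bullet>) D" and na: "C \<noteq> abelian4"
    and ideal: "\<And>x y. C x y $ 4 = 0"
    and unim: "\<And>x. x $ 4 = 0 \<Longrightarrow> C x e1 $ 1 + C x e2 $ 2 + C x e3 $ 3 = 0"
    and diag: "C e2 e3 $ 2 = 0" "(C e3 e1 $ 2)\<^sup>2 \<le> (C e2 e3 $ 1)\<^sup>2"
  shows "classified_extension C (\<bullet>) D"
proof -
  have K: "kaehler C J4 (\<bullet>)" and D: "linear D" "\<And>x y. D x \<bullet> y = - (x \<bullet> D y)" "\<And>x. D (J4 x) = J4 (D x)"
    and der: "\<And>x y. D (C x y) = C (D x) y + C x (D y)"
    using E unfolding extension_data_def lie_derivation_def by blast+
  obtain p q x y where De: "D e1 = vec4 0 p x y" "D e2 = vec4 (- p) 0 (- y) x"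
    "D e3 = vec4 (- x) y 0 q" "D e4 = vec4 (- y) (- x) (- q) 0"
    by (rule skew_hermitian_form[OF D])
  obtain l1 l2 u1 u2 c s b where C: "C = normal_bracket l1 l2 u1 u2 c s b"
    and l: "l1 = C e2 e3 $ 1" "l2 = C e3 e1 $ 2"
    and eqs: "2 * (l1\<^sup>2 + u1\<^sup>2) = ((l1 + l2 + c) / 2 + s) * l1"
    "2 * (l2\<^sup>2 + u2\<^sup>2) = ((l1 + l2 + c) / 2 + s) * l2"
    "2 * u1 * u2 + b * (l1 - l2) = 0"
    "2 * (l1 * u1 + u1 * c) - (l1 + l2 + c) / 2 * u1 - b * u2 = 0"
    "2 * (l2 * u2 + u2 * c) - (l1 + l2 + c) / 2 * u2 + b * u1 = 0"
    "2 * (u1\<^sup>2 + u2\<^sup>2 + c\<^sup>2) + (s - (l1 + l2 + c) / 2) * c = 0"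
    by (rule kaehler_normal_form[OF K ideal unim diag(1)])
  have ord: "l2\<^sup>2 \<le> l1\<^sup>2" using diag l by simp
  note ders = der[of e2 e3] der[of e3 e1] der[of e1 e2] der[of e4 e1] der[of e4 e2] der[of e4 e3]
  have lins: "D (vec4 v1 v2 v3 v4) = vec4 (- p * v2 - x * v3 - y * v4) (p * v1 + y * v3 - x * v4)
    (x * v1 - y * v2 - q * v4) (y * v1 + x * v2 + q * v3)" for v1 v2 v3 v4
    by (subst linear_vec4_expand[OF D(1)]) (simp add: De algebra_simps)
  have Drot: "D = rot4 p 0" if "x = 0" "y = 0" "q = 0"
    using De that by (intro rot4_eqI[OF D(1)]) simp_all
  show ?thesis
  proof (rule normal_form_cases[OF eqs ord])
    assume z: "l1 = l2" "u1 = 0" "u2 = 0" "c = 0" "s = l1"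
    have nz: "l1 \<noteq> 0 \<or> b \<noteq> 0" using na normal_bracket_zero unfolding C z by metis
    have "x = 0 \<and> y = 0 \<and> q = 0"
      using ders nz unfolding C normal_bracket_def z by (auto simp: table4_simps lins)
    then have D4: "D = rot4 p 0" by (auto intro: Drot)
    have "\<gg>1_fam 0 \<in> first_family" unfolding first_family_def by auto
    then show ?thesis
      unfolding classified_extension_def C z(2-5) z(1)[symmetric] D4
      using flat_normal iso_rr'_3_0[OF nz] iso_g1_fam_0[OF nz] by blast
  next
    assume z: "l1 = 0" "l2 = 0" "u1 = 0" "u2 = 0" "c = 0" "s \<noteq> 0"
    have *: "q = 0" "s * x = b * y" "s * y = - b * x"
      using ders z(6) unfolding C normal_bracket_def z(1-5) by (simp_all add: table4_simps lins)
    have "(s\<^sup>2 + b\<^sup>2) * x = 0" "(s\<^sup>2 + b\<^sup>2) * y = 0" using *(2,3) by algebra+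
    then have "x = 0 \<and> y = 0" using z(6) by (auto simp: sum_power2_eq_zero_iff)
    then have D4: "D = rot4 p 0" using * by (auto intro: Drot)
    have C': "C = normal_bracket 0 0 0 0 0 s b" using C z by simp
    consider "p \<noteq> 0" | "p = 0" "b = 0" | "p = 0" "b \<noteq> 0" by blast
    then obtain M where "M \<in> remaining_lines" "lie_isomorphic (ext_bracket C D) M"
    proof cases
      case 1
      then show ?thesis using that iso_g1[OF z(6)] unfolding C' D4 remaining_lines_def by blast
    next
      case 2
      then show ?thesis using that iso_g5[OF z(6)] unfolding C' D4 remaining_lines_def by blast
    next
      case 3
      then have "\<bar>b / s\<bar> > 0" using z by simp
      then show ?thesis using that iso_g6[OF z(6) 3(2)] 3(1) unfolding C' D4 remaining_lines_def by blast
    qed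
    then show ?thesis
      using has_ad_eigenvector_normal(1)[OF z(6)] D(1) unfolding C' by (intro classified_nonflat)
  next
    assume z: "l1 = 0" "l2 = 0" "u1 = 0" "u2 = 0" "c \<noteq> 0" "s = - 3 * c / 2"
    have "q = 0 \<and> x = 0 \<and> y = 0"
      using ders z(5) unfolding C normal_bracket_def z(1-4) z(6) by (auto simp: table4_simps lins)
    then have D4: "D = rot4 p 0" by (auto intro: Drot)
    have C': "C = normal_bracket 0 0 0 0 c (- 3 * c / 2) b" using C z by simp
    consider "p \<noteq> 0" | "p = 0" "b = 0" | "p = 0" "b \<noteq> 0" by blast
    then obtain M where "M \<in> remaining_lines" "lie_isomorphic (ext_bracket C D) M"
    proof cases
      case 1
      then show ?thesis using that iso_g4[OF z(5)] unfolding C' D4 remaining_lines_def by blast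
    next
      case 2
      then show ?thesis using that iso_g7[OF z(5)] unfolding C' D4 remaining_lines_def by blast
    next
      case 3
      then have "\<bar>c / b\<bar> > 0" using z by simp
      then show ?thesis using that iso_g8[OF z(5) 3(2)] 3(1) unfolding C' D4 remaining_lines_def by blast
    qed
    then show ?thesis
      using has_ad_eigenvector_normal(2)[OF z(5)] D(1) unfolding C' by (intro classified_nonflat)
  next
    assume z: "l1 \<noteq> 0" "l2 = 0" "u1 = 0" "u2 = 0" "c = 0" "s = 3 * l1 / 2" "b = 0"
    have *: "q = 0 \<and> x = 0 \<and> y = 0 \<and> p = 0"
      using ders z(1) unfolding C normal_bracket_def z(2-7) by (auto simp: table4_simps lins)
    then have D4: "D = rot4 0 0" using Drot by auto
    have C': "C = normal_bracket l1 0 0 0 0 (3 * l1 / 2) 0" using C z by simp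
    have "lie_isomorphic (ext_bracket C D) \<gg>3" using iso_g3[OF z(1)] unfolding C' D4 .
    moreover have "\<gg>3 \<in> remaining_lines" unfolding remaining_lines_def by blast
    ultimately show ?thesis
      using has_ad_eigenvector_normal(3)[OF z(1)] D(1) unfolding C' by (intro classified_nonflat)
  next
    assume z: "l1 \<noteq> 0" "l2 = 0" "u2 = 0" "c = - l1" "s * l1 = 2 * (l1\<^sup>2 + u1\<^sup>2)" "b = 0"
    have "q * s = 0" "y * s = 0" "x = 0" "(p + q) * l1 = 0"
      using ders z(1) unfolding C normal_bracket_def z(2-4) z(6)
      by (auto simp: table4_simps lins algebra_simps)
    moreover have "l1\<^sup>2 + u1\<^sup>2 > 0" using z(1) by (simp add: sum_power2_gt_zero_iff)
    then have "s \<noteq> 0" using z(5) by auto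
    ultimately have *: "q = 0 \<and> x = 0 \<and> y = 0 \<and> p = 0" using z(1) by auto
    then have D4: "D = rot4 0 0" using Drot by auto
    have C': "C = normal_bracket l1 0 u1 0 (- l1) s 0" using C z by simp
    have "lie_isomorphic (ext_bracket C D) \<gg>2" using iso_g2[OF z(1,5)] unfolding C' D4 .
    moreover have "\<gg>2 \<in> remaining_lines" unfolding remaining_lines_def by blast
    ultimately show ?thesis
      using has_ad_eigenvector_r2r2[OF z(1)] D(1) unfolding C' by (intro classified_nonflat)
  qed
qed

section \<open>A codimension-one ideal\<close>

definition ad_trace :: "(real^4 \<Rightarrow> real^4 \<Rightarrow> real^4) \<Rightarrow> real^4 \<Rightarrow> real" where
  "ad_trace C x = C x e1 $ 1 + C x e2 $ 2 + C x e3 $ 3 + C x e4 $ 4"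

lemma axis_vec4: "axis 1 1 = e1" "axis 2 1 = e2" "axis 3 1 = e3" "axis 4 1 = e4"
  by (auto intro!: vec4_eqI simp: axis_def)

lemma trace_matrix4: "trace (matrix f) = f e1 $ 1 + f e2 $ 2 + f e3 $ 3 + f e4 $ (4::4)"
  by (simp add: trace_def matrix_def sum_4 axis_vec4)

lemma trace_compose_swap:
  fixes f g :: "real^'n \<Rightarrow> real^'n"
  assumes "linear f" "linear g"
  shows "trace (matrix (f \<circ> g)) = trace (matrix (g \<circ> f))"
  unfolding matrix_compose[OF assms] matrix_compose[OF assms(2,1)] by (rule trace_mul_sym)

lemma ad_trace_eq: "ad_trace C x = trace (matrix (C x))"
  by (simp add: ad_trace_def trace_matrix4)

text \<open>By the Jacobi identity \<open>ad [x, y]\<close> is the commutator of \<open>ad x\<close>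
  and \<open>ad y\<close>, so its trace is zero.\<close>

lemma ad_trace_bracket:
  assumes "lie_algebra C"
  shows "ad_trace C (C x y) = 0"
proof -
  have C: "bilinear C" "\<And>x. C x x = 0" and jac: "\<And>x y z. C x (C y z) + C y (C z x) + C z (C x y) = 0"
    using assms unfolding lie_algebra_def by blast+
  have l: "linear (C x)" for x using C(1) by (simp add: bilinear_def)
  have "C (C x y) z = C x (C y z) - C y (C x z)" for z
    using jac[of x y z] bilinear_alternating_swap[OF C, of z] bilinear_rneg[OF C(1)]
    by (metis (no_types, lifting) add.commute add_diff_cancel_left' diff_conv_add_uminus eq_neg_iff_add_eq_0)
  then have "ad_trace C (C x y) = trace (matrix (C x \<circ> C y)) - trace (matrix (C y \<circ> C x))"
    by (simp add: ad_trace_def trace_matrix4)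
  then show ?thesis using trace_compose_swap[OF l l, of x y] by simp
qed

lemma linear_ad_trace:
  assumes "bilinear C"
  shows "linear (ad_trace C)"
  by (rule linearI) (simp_all add: ad_trace_def bilinear_ladd[OF assms] bilinear_lmul[OF assms] algebra_simps)

lemma linear_functional_vec4:
  assumes "linear f"
  shows "f x = vec4 (f e1) (f e2) (f e3) (f e4) \<bullet> (x::real^4)"
  unfolding linear_vec4_expand[OF assms, of x] inner_vec4 by simp

text \<open>In the unimodular case choose \<open>g\<close> such that the two-form \<open>dg\<close> is self-dual. As
  \<open>d (g \<and> dg) = 0\<close> by unimodularity, \<open>\<parallel>dg\<parallel>\<^sup>2 vol = dg \<and> dg = 0\<close>.\<close>

lemma exists_closed_one_form:
  assumes "lie_algebra C"
  obtains g :: "real^4" where "g \<noteq> 0" "\<And>x y. g \<bullet> C x y = 0" "\<And>x. g \<bullet> x = 0 \<Longrightarrow> ad_trace C x = 0"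
proof -
  have C: "bilinear C" "\<And>x. C x x = 0" and jac: "\<And>x y z. C x (C y z) + C y (C z x) + C z (C x y) = 0"
    using assms unfolding lie_algebra_def by blast+
  have l: "linear (C x)" for x using C(1) by (simp add: bilinear_def)
  note sw = bilinear_alternating_swap[OF C]
  show ?thesis
  proof (cases "\<forall>x. ad_trace C x = 0")
    case False
    \<comment> \<open>A non-zero trace form is itself closed, and its kernel satisfies the trace
      condition by definition.\<close>
    define g where "g = vec4 (ad_trace C e1) (ad_trace C e2) (ad_trace C e3) (ad_trace C e4)"
    have g: "ad_trace C x = g \<bullet> x" for x
      unfolding g_def by (rule linear_functional_vec4[OF linear_ad_trace[OF C(1)]])
    have "g \<noteq> 0" using False g by auto
    then show ?thesis
      using ad_trace_bracket[OF assms] by (intro that[of g]) (simp_all flip: g)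
  next
    case True
    \<comment> \<open>The components of the anti-self-dual part of \<open>dg\<close>, up to sign.
      The last coordinate 0 makes \<open>h\<close> an endomorphism that misses \<open>e4\<close>, so
      it has a kernel.\<close>
    define h where "h g = vec4 (g \<bullet> (C e1 e2 - C e3 e4)) (g \<bullet> (C e1 e3 + C e2 e4)) (g \<bullet> (C e1 e4 - C e2 e3)) 0" for g
    have lh: "linear h" by (rule linearI) (simp_all add: h_def inner_add_left)
    have "\<not> inj h"
    proof
      assume "inj h"
      then have "surj h" using lh by (simp add: linear_injective_imp_surjective)
      then obtain z where "h z = e4" by (metis surjD)
      then show False by (simp add: h_def)
    qed
    then obtain g where g: "g \<noteq> 0" "h g = 0" using linear_injective_0[OF lh] by blast
    define a12 a13 a14 where "a12 = g \<bullet> C e1 e2" "a13 = g \<bullet> C e1 e3" "a14 = g \<bullet> C e1 e4"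
    have a: "g \<bullet> C e3 e4 = a12" "g \<bullet> C e2 e4 = - a13" "g \<bullet> C e2 e3 = a14"
      using g(2) by (auto simp: h_def a12_a13_a14_def inner_diff_right inner_add_right)
    have "2 * (a12\<^sup>2 + a13\<^sup>2 + a14\<^sup>2) = 0"
    proof -
      note t = True[rule_format, of e1] True[rule_format, of e2] True[rule_format, of e3] True[rule_format, of e4]
      have t': "C e1 e2 $ 2 + C e1 e3 $ 3 + C e1 e4 $ 4 = 0" "- C e1 e2 $ 1 + C e2 e3 $ 3 + C e2 e4 $ 4 = 0"
         "- C e1 e3 $ 1 - C e2 e3 $ 2 + C e3 e4 $ 4 = 0" "- C e1 e4 $ 1 - C e2 e4 $ 2 - C e3 e4 $ 3 = 0"
        using t sw[of e2 e1] sw[of e3 e1] sw[of e4 e1] sw[of e3 e2] sw[of e4 e2] sw[of e4 e3]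
        by (simp_all add: ad_trace_def C)
      have \<phi>: "g \<bullet> C e1 w = w $ 2 * a12 + w $ 3 * a13 + w $ 4 * a14"
        "g \<bullet> C e2 w = - w $ 1 * a12 + w $ 3 * a14 - w $ 4 * a13"
        "g \<bullet> C e3 w = - w $ 1 * a13 - w $ 2 * a14 + w $ 4 * a12"
        "g \<bullet> C e4 w = - w $ 1 * a14 + w $ 2 * a13 - w $ 3 * a12" for w
        unfolding linear_vec4_expand[OF l, of _ w] using a
        by (simp_all add: inner_add_right inner_diff_right C sw[of e2 e1] sw[of e3 e1] sw[of e4 e1] sw[of e3 e2]
            sw[of e4 e2] sw[of e4 e3] flip: a12_a13_a14_def)
      have j: "g \<bullet> C x (C y z) + g \<bullet> C y (C z x) + g \<bullet> C z (C x y) = 0" for x y z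
        by (metis jac inner_add_right inner_zero_right)
      note j' = j[of e2 e3 e4, unfolded \<phi> sw[of e4 e2]] j[of e1 e3 e4, unfolded \<phi> sw[of e4 e1]]
        j[of e1 e2 e4, unfolded \<phi> sw[of e4 e1]] j[of e1 e2 e3, unfolded \<phi> sw[of e3 e1]]
      have g': "a12 = g $ 1 * C e1 e2 $ 1 + g $ 2 * C e1 e2 $ 2 + g $ 3 * C e1 e2 $ 3 + g $ 4 * C e1 e2 $ 4"
        "a13 = g $ 1 * C e1 e3 $ 1 + g $ 2 * C e1 e3 $ 2 + g $ 3 * C e1 e3 $ 3 + g $ 4 * C e1 e3 $ 4"
        "a14 = g $ 1 * C e1 e4 $ 1 + g $ 2 * C e1 e4 $ 2 + g $ 3 * C e1 e4 $ 3 + g $ 4 * C e1 e4 $ 4"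
        "a12 = g $ 1 * C e3 e4 $ 1 + g $ 2 * C e3 e4 $ 2 + g $ 3 * C e3 e4 $ 3 + g $ 4 * C e3 e4 $ 4"
        "- a13 = g $ 1 * C e2 e4 $ 1 + g $ 2 * C e2 e4 $ 2 + g $ 3 * C e2 e4 $ 3 + g $ 4 * C e2 e4 $ 4"
        "a14 = g $ 1 * C e2 e3 $ 1 + g $ 2 * C e2 e3 $ 2 + g $ 3 * C e2 e3 $ 3 + g $ 4 * C e2 e3 $ 4"
        using a unfolding inner_vec4[of g] by (simp_all add: a12_a13_a14_def inner_vec4)
      have "(0 + (- C e3 e4 $ 1 * a12 + C e3 e4 $ 3 * a14 - C e3 e4 $ 4 * a13) - (- C e2 e4 $ 1 * a13 - C e2 e4 $ 2 * a14 + C e2 e4 $ 4 * a12) + (- C e2 e3 $ 1 * a14 + C e2 e3 $ 2 * a13 - C e2 e3 $ 3 * a12)) = 0" "(0 + (C e3 e4 $ 2 * a12 + C e3 e4 $ 3 * a13 + C e3 e4 $ 4 * a14) - (- C e1 e4 $ 1 * a13 - C e1 e4 $ 2 * a14 + C e1 e4 $ 4 * a12) + (- C e1 e3 $ 1 * a14 + C e1 e3 $ 2 * a13 - C e1 e3 $ 3 * a12)) = 0" "(0 + (C e2 e4 $ 2 * a12 + C e2 e4 $ 3 * a13 + C e2 e4 $ 4 * a14) - (- C e1 e4 $ 1 * a12 + C e1 e4 $ 3 * a14 - C e1 e4 $ 4 * a13) + (- C e1 e2 $ 1 * a14 + C e1 e2 $ 2 * a13 - C e1 e2 $ 3 * a12))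 = 0" "(0 + (C e2 e3 $ 2 * a12 + C e2 e3 $ 3 * a13 + C e2 e3 $ 4 * a14) - (- C e1 e3 $ 1 * a12 + C e1 e3 $ 3 * a14 - C e1 e3 $ 4 * a13) + (- C e1 e2 $ 1 * a13 - C e1 e2 $ 2 * a14 + C e1 e2 $ 4 * a12)) = 0"
        using j' by simp_all
      note jj = this
      \<comment> \<open>Coordinates of
        \<open>dg \<and> dg = d (g \<and> dg) + g \<and> d (dg)\<close>, up to signs. The first four
        summands contain the traces \<open>t'\<close>, the remaining ones the Jacobi sums
        \<open>jj\<close>. Inner products with \<open>g\<close> are written out to make this a
        polynomial identity, and \<open>g'\<close> folds them back afterwards.\<close>
      have "a12 * ((g $ 1 * C e1 e2 $ 1 + g $ 2 * C e1 e2 $ 2 + g $ 3 * C e1 e2 $ 3 + g $ 4 * C e1 e2 $ 4) + (g $ 1 * C e3 e4 $ 1 + g $ 2 * C e3 e4 $ 2 + g $ 3 * C e3 e4 $ 3 + g $ 4 * C e3 e4 $ 4)) + a13 * ((g $ 1 * C e1 e3 $ 1 + g $ 2 * C e1 e3 $ 2 + g $ 3 * C e1 e3 $ 3 + g $ 4 * C e1 e3 $ 4) - (g $ 1 * C e2 e4 $ 1 + g $ 2 * C e2 e4 $ 2 + g $ 3 * C e2 e4 $ 3 + g $ 4 * C e2 e4 $ 4)) + a14 * ((g $ 1 * C e1 e4 $ 1 + g $ 2 * C e1 e4 $ 2 + g $ 3 * C e1 e4 $ 3 + g $ 4 * C e1 e4 $ 4) + (g $ 1 * C e2 e3 $ 1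 + g $ 2 * C e2 e3 $ 2 + g $ 3 * C e2 e3 $ 3 + g $ 4 * C e2 e3 $ 4)) =
        (g $ 2 * a12 + g $ 3 * a13 + g $ 4 * a14) * (C e1 e2 $ 2 + C e1 e3 $ 3 + C e1 e4 $ 4) + (- g $ 1 * a12 + g $ 3 * a14 - g $ 4 * a13) * (- C e1 e2 $ 1 + C e2 e3 $ 3 + C e2 e4 $ 4) + (- g $ 1 * a13 - g $ 2 * a14 + g $ 4 * a12) * (- C e1 e3 $ 1 - C e2 e3 $ 2 + C e3 e4 $ 4) + (- g $ 1 * a14 + g $ 2 * a13 - g $ 3 * a12) * (- C e1 e4 $ 1 - C e2 e4 $ 2 - C e3 e4 $ 3) -
        (g $ 1 * (0 + (- C e3 e4 $ 1 * a12 + C e3 e4 $ 3 * a14 - C e3 e4 $ 4 * a13) - (- C e2 e4 $ 1 * a13 - C e2 e4 $ 2 * a14 + C e2 e4 $ 4 * a12) + (- C e2 e3 $ 1 * a14 + C e2 e3 $ 2 * a13 - C e2 e3 $ 3 * a12)) - g $ 2 * (0 + (C e3 e4 $ 2 * a12 + C e3 e4 $ 3 * a13 + C e3 e4 $ 4 * a14) - (- C e1 e4 $ 1 * a13 - C e1 e4 $ 2 * a14 + C e1 e4 $ 4 * a12) + (- C e1 e3 $ 1 * a14 + C e1 e3 $ 2 * a13 - C e1 e3 $ 3 * a12)) + g $ 3 * (0 + (C e2 e4 $ 2 * a12 + C e2 e4 $ 3 * a13 + C e2 e4 $ 4 * a14) - (- C e1 e4 $ 1 * a12 + C e1 e4 $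 3 * a14 - C e1 e4 $ 4 * a13) + (- C e1 e2 $ 1 * a14 + C e1 e2 $ 2 * a13 - C e1 e2 $ 3 * a12)) - g $ 4 * (0 + (C e2 e3 $ 2 * a12 + C e2 e3 $ 3 * a13 + C e2 e3 $ 4 * a14) - (- C e1 e3 $ 1 * a12 + C e1 e3 $ 3 * a14 - C e1 e3 $ 4 * a13) + (- C e1 e2 $ 1 * a13 - C e1 e2 $ 2 * a14 + C e1 e2 $ 4 * a12)))"
        by (simp add: algebra_simps)
      also have "\<dots> = 0" unfolding t' jj by simp
      finally show ?thesis unfolding g'[symmetric] by (simp add: power2_eq_square algebra_simps)
    qed
    then have "a12\<^sup>2 + a13\<^sup>2 + a14\<^sup>2 = 0" by simp
    then have z: "a12 = 0" "a13 = 0" "a14 = 0"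
      by (metis add_nonneg_eq_0_iff add_nonneg_nonneg zero_eq_power2 zero_le_power2)+
    have "g \<bullet> C x y = 0" for x y
      using a z sw[of e4 e1] sw[of e4 e2] sw[of e4 e3] sw[of e3 e1]
      by (subst bilinear_alternating_table[OF C]) (simp add: table_bracket_def inner_add_right inner_diff_right a12_a13_a14_def)
    then show ?thesis using g(1) True by (intro that[of g]) auto
  qed
qed

section \<open>Adapted unitary bases\<close>

definition frame :: "('a::real_vector \<Rightarrow> 'a) \<Rightarrow> 'a \<Rightarrow> 'a \<Rightarrow> real^4 \<Rightarrow> 'a" where
  "frame J v w x = x $ 1 *\<^sub>R v + x $ 2 *\<^sub>R J v + x $ 3 *\<^sub>R w + x $ 4 *\<^sub>R J w"

text \<open>Orthonormality for the Hermitian form of \<open>ip\<close> and \<open>J\<close>; the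
  remaining relations among \<open>v\<close>, \<open>J v\<close>, \<open>w\<close>,
  \<open>J w\<close> follow because \<open>J\<close> is skew and orthogonal.\<close>

definition unitary_pair :: "('a::real_vector \<Rightarrow> 'a) \<Rightarrow> ('a \<Rightarrow> 'a \<Rightarrow> real) \<Rightarrow> 'a \<Rightarrow> 'a \<Rightarrow> bool" where
  "unitary_pair J ip v w \<longleftrightarrow> ip v v = 1 \<and> ip w w = 1 \<and> ip v w = 0 \<and> ip v (J w) = 0"

lemma frame_unitary:
  fixes J :: "'a::real_vector \<Rightarrow> 'a"
  assumes dim: "dim (UNIV :: 'a set) = 4" and K: "kaehler C J ip" and vw: "unitary_pair J ip v w"
  shows "linear_bij (frame J v w)" "ip (frame J v w x) (frame J v w y) = x \<bullet> y"
    "J (frame J v w x) = frame J v w (J4 x)"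
proof -
  have lJ: "linear J" and IP: "inner_product ip" and J2: "\<And>x. J (J x) = - x"
    and iJ: "\<And>x y. ip (J x) (J y) = ip x y"
    using K unfolding kaehler_def by blast+
  have bi: "bilinear ip" and sym: "\<And>x y. ip x y = ip y x"
    using IP unfolding inner_product_def by blast+
  note s = bilinear_ladd[OF bi] bilinear_radd[OF bi] bilinear_lmul[OF bi] bilinear_rmul[OF bi]
  have skew: "ip (J a) b = - ip a (J b)" for a b
    using iJ[of a "J b"] by (simp add: J2 bilinear_rneg[OF bi])
  have self: "ip a (J a) = 0" "ip (J a) a = 0" for a
    using skew[of a a] sym[of a "J a"] by auto
  have *: "ip v v = 1" "ip w w = 1" "ip v w = 0" "ip w v = 0" "ip v (J w) = 0" "ip (J w) v = 0"
    "ip w (J v) = 0" "ip (J v) w = 0"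
    using vw skew[of v w] sym[of w v] sym[of "J w" v] sym[of w "J v"] unfolding unitary_pair_def by simp_all
  show iso: "ip (frame J v w x) (frame J v w y) = x \<bullet> y" for x y
    by (simp add: frame_def s self * iJ inner_vec4)
  show "J (frame J v w x) = frame J v w (J4 x)"
    by (simp add: frame_def J4_def linear_add[OF lJ] linear_scale[OF lJ] J2)
  have lin: "linear (frame J v w)"
    by (rule linearI) (simp_all add: frame_def algebra_simps)
  have "inj (frame J v w)"
    unfolding linear_injective_0[OF lin]
    using iso by (metis bilinear_lzero[OF bi] inner_eq_zero_iff)
  then show "linear_bij (frame J v w)"
    using lin dim by (simp add: linear_bij_def bij_of_inj_linear)
qed

text \<open>One complex Gram-Schmidt step: two vectors cannot span a space of dimension four, so
  some \<open>y\<close> lies outside the complex line of a unit vector \<open>v\<close>.\<close>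

lemma exists_unitary_pair:
  fixes J :: "'a::real_vector \<Rightarrow> 'a"
  assumes dim: "dim (UNIV :: 'a set) = 4" and K: "kaehler C J ip"
  obtains v w where "unitary_pair J ip v w"
proof -
  have lJ: "linear J" and IP: "inner_product ip" and J2: "\<And>x. J (J x) = - x"
    and iJ: "\<And>x y. ip (J x) (J y) = ip x y"
    using K unfolding kaehler_def by blast+
  have bi: "bilinear ip" and sym: "\<And>x y. ip x y = ip y x" and pos: "\<And>x. x \<noteq> 0 \<Longrightarrow> ip x x > 0"
    using IP unfolding inner_product_def by blast+
  note s = bilinear_ladd[OF bi] bilinear_radd[OF bi] bilinear_lmul[OF bi] bilinear_rmul[OF bi]
    bilinear_lsub[OF bi] bilinear_rsub[OF bi]
  have skew: "ip (J a) b = - ip a (J b)" for a b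
    using iJ[of a "J b"] by (simp add: J2 bilinear_rneg[OF bi])
  have self: "ip a (J a) = 0" "ip (J a) a = 0" for a
    using skew[of a a] sym[of a "J a"] by auto
  have normalize: "ip ((1 / sqrt (ip z z)) *\<^sub>R z) ((1 / sqrt (ip z z)) *\<^sub>R z) = 1" if "z \<noteq> 0" for z
    using pos[OF that] by (simp add: s power2_eq_square[symmetric])
  have notspan: "\<exists>y. y \<notin> span S" if "finite S" "card S < 4" for S :: "'a set"
    using dim_le_card[of UNIV S] that dim by fastforce
  obtain a :: 'a where "a \<noteq> 0" using notspan[of "{}"] by auto
  then obtain v where v: "ip v v = 1" using normalize by blast
  have "card {v, J v} < 4" using card_insert_le_m1[of 3 "{J v}" v] by (simp add: card_insert_if)
  then obtain y where y: "y \<notin> span {v, J v}" using notspan[of "{v, J v}"] by auto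
  define z where "z = y - (ip y v *\<^sub>R v + ip y (J v) *\<^sub>R J v)"
  have "z \<noteq> 0"
  proof
    assume "z = 0"
    then have "y = ip y v *\<^sub>R v + ip y (J v) *\<^sub>R J v" by (simp add: z_def)
    moreover have "\<dots> \<in> span {v, J v}" by (intro span_add span_scale span_base) auto
    ultimately show False using y by simp
  qed
  have "ip v z = 0" "ip (J v) z = 0"
    by (simp_all add: z_def s v self iJ sym)
  then have "unitary_pair J ip v ((1 / sqrt (ip z z)) *\<^sub>R z)"
    using v normalize[OF \<open>z \<noteq> 0\<close>] skew[of v z] by (simp add: unitary_pair_def s linear_scale[OF lJ])
  then show ?thesis by (rule that)
qed

lemma (in linear_bij) classified_extension_pull:
  assumes "classified_extension (pull f C) (\<lambda>x y. ip (f x) (f y)) (inv f \<circ> D \<circ> f)"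
  shows "classified_extension C ip D"
  using assms unfolding classified_extension_def flat_metric_ext_pull
  by (meson has_ad_eigenvector_transfer lie_isomorphic_pull lie_isomorphic_ext_pull
      lie_isomorphic_sym lie_isomorphic_trans)

text \<open>A unitary frame turns \<open>J\<close> into \<open>J4\<close> and \<open>ip\<close> into
  the standard inner product, so only the bracket and \<open>D\<close> still vary.\<close>

lemma frame_pull:
  fixes J :: "'a::real_vector \<Rightarrow> 'a"
  assumes dim: "dim (UNIV :: 'a set) = 4" and E: "extension_data C J ip D" and vw: "unitary_pair J ip v w"
  defines "f \<equiv> frame J v w"
  shows "extension_data (pull f C) J4 (\<bullet>) (inv f \<circ> D \<circ> f)"
    "classified_extension (pull f C) (\<bullet>) (inv f \<circ> D \<circ> f) \<Longrightarrow> classified_extension C ip D"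
proof -
  have K: "kaehler C J ip" using E unfolding extension_data_def by blast
  interpret linear_bij f unfolding f_def by (rule frame_unitary[OF dim K vw])
  have ip: "(\<lambda>x y. ip (f x) (f y)) = (\<bullet>)"
    unfolding f_def by (intro ext) (rule frame_unitary[OF dim K vw])
  have J: "inv f \<circ> J \<circ> f = J4"
  proof
    have "J (f x) = f (J4 x)" for x unfolding f_def by (rule frame_unitary(3)[OF dim K vw])
    then show "(inv f \<circ> J \<circ> f) x = J4 x" for x by simp
  qed
  show "extension_data (pull f C) J4 (\<bullet>) (inv f \<circ> D \<circ> f)"
    using extension_data_pull[OF E] unfolding ip J .
  show "classified_extension C ip D" if "classified_extension (pull f C) (\<bullet>) (inv f \<circ> D \<circ> f)"
    using that classified_extension_pull[of C ip D] unfolding ip by blast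
qed

text \<open>Since \<open>f e4 = J4 w\<close> is parallel to \<open>g\<close>, the closed form
  \<open>g\<close> becomes a multiple of the fourth coordinate. The trace form is carried over
  because traces are invariant under conjugation.\<close>

lemma frame_pull_adapted:
  assumes E: "extension_data C J4 (\<bullet>) D" and vw: "unitary_pair J4 (\<bullet>) v w"
    and g: "\<And>x y. g \<bullet> C x y = 0" "\<And>x. g \<bullet> x = 0 \<Longrightarrow> ad_trace C x = 0" "J4 w = r *\<^sub>R g"
  defines "f \<equiv> frame J4 v w"
  shows "\<And>x y. pull f C x y $ 4 = 0" "\<And>x. x $ 4 = 0 \<Longrightarrow> ad_trace (pull f C) x = 0"
    "\<And>x y z. pull f C x y \<bullet> z = C (f x) (f y) \<bullet> f z"
proof -
  have K: "kaehler C J4 (\<bullet>)" using E unfolding extension_data_def by blast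
  have bC: "bilinear C" using K unfolding kaehler_def lie_algebra_def by blast
  have dim: "dim (UNIV :: (real^4) set) = 4" by simp
  interpret linear_bij f unfolding f_def by (rule frame_unitary[OF dim K vw])
  have ip: "f x \<bullet> f y = x \<bullet> y" for x y
    unfolding f_def by (rule frame_unitary[OF dim K vw])
  show p: "pull f C x y \<bullet> z = C (f x) (f y) \<bullet> f z" for x y z
    using ip[of "pull f C x y" z] by (simp add: pull_def)
  have fe4: "f e4 = r *\<^sub>R g" by (simp add: f_def frame_def g(3))
  show "pull f C x y $ 4 = 0" for x y
    using p[of x y e4] g(1) by (simp add: fe4 inner_vec4[of _ e4] inner_commute[of _ g])
  show "ad_trace (pull f C) x = 0" if "x $ 4 = 0" for x
  proof -
    have "r * (g \<bullet> f x) = 0" using ip[of e4 x] that by (simp add: fe4 inner_vec4[of e4])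
    moreover have "r \<noteq> 0" using ip[of e4 e4] by (auto simp: fe4)
    ultimately have z: "ad_trace C (f x) = 0" using g(2) by simp
    have "ad_trace (pull f C) x = trace (matrix (inv f \<circ> (C (f x) \<circ> f)))"
      unfolding ad_trace_eq by (simp add: pull_def[abs_def] comp_def)
    also have "\<dots> = trace (matrix ((C (f x) \<circ> f) \<circ> inv f))"
      using bC lin by (intro trace_compose_swap lin_inv linear_compose) (auto simp: bilinear_def)
    also have "(C (f x) \<circ> f) \<circ> inv f = C (f x)" by (rule ext) simp
    finally show ?thesis using z by (simp add: ad_trace_eq)
  qed
qed

text \<open>Diagonalizes the symmetric matrix with rows \<open>(l1, p)\<close>,
  \<open>(p, l2)\<close>: if \<open>((l1 - l2) / 2, p)\<close> has polar angle
  \<open>\<phi>\<close>, rotating by half that angle removes the off-diagonal entry.\<close>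

lemma exists_diagonalizing_rotation:
  fixes l1 l2 p :: real
  obtains c s where "c\<^sup>2 + s\<^sup>2 = 1" "(c\<^sup>2 - s\<^sup>2) * p - c * s * (l1 - l2) = 0"
    "(c\<^sup>2 * l2 - 2 * c * s * p + s\<^sup>2 * l1)\<^sup>2 \<le> (c\<^sup>2 * l1 + 2 * c * s * p + s\<^sup>2 * l2)\<^sup>2"
proof -
  obtain r \<phi> where "Complex ((l1 - l2) / 2) p = rcis r \<phi>" using rcis_Ex by blast
  then have r: "(l1 - l2) / 2 = r * cos \<phi>" "p = r * sin \<phi>" by (auto simp: rcis_def complex_eq_iff)
  define c s where "c = cos (\<phi> / 2)" and "s = sin (\<phi> / 2)"
  have cs: "c\<^sup>2 + s\<^sup>2 = 1" by (simp add: c_def s_def)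
  have "cos \<phi> = c\<^sup>2 - s\<^sup>2" "sin \<phi> = 2 * s * c"
    using cos_double[of "\<phi> / 2"] sin_double[of "\<phi> / 2"] by (simp_all add: c_def s_def)
  then have "l1 - l2 = 2 * r * (c\<^sup>2 - s\<^sup>2)" "p = r * (2 * s * c)"
    using r by simp_all
  then have eq: "(c\<^sup>2 - s\<^sup>2) * p - c * s * (l1 - l2) = 0"
    by simp
  show ?thesis
  proof (cases "(c\<^sup>2 * l2 - 2 * c * s * p + s\<^sup>2 * l1)\<^sup>2 \<le> (c\<^sup>2 * l1 + 2 * c * s * p + s\<^sup>2 * l2)\<^sup>2")
    case True
    then show ?thesis using that cs eq by blast
  next
    case False
    \<comment> \<open>A further quarter turn exchanges the two eigenvalues.\<close>
    show ?thesis
      by (rule that[of "- s" c]) (use cs eq False in \<open>simp_all add: algebra_simps\<close>)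
  qed
qed


lemma pull_abelian4: "linear_bij f \<Longrightarrow> pull f abelian4 = abelian4"
  by (intro ext) (simp add: pull_def abelian4_def table_bracket_def linear_0[OF linear_bij.lin_inv])

text \<open>\<open>(y, x, \<mu> - p, 0)\<close> spans the eigenspace of the Hermitian matrix \<open>- J D\<close> for its larger eigenvalue \<open>\<mu>\<close>.\<close>

lemma skew_hermitian_eigenvector:
  assumes D: "linear D" "\<And>x y. D x \<bullet> y = - (x \<bullet> D y)" "\<And>x. D (J4 x) = J4 (D x)"
  obtains v \<mu> where "v \<bullet> v = 1" "D v = \<mu> *\<^sub>R J4 v"
proof -
  obtain p q x y where De: "D e1 = vec4 0 p x y" "D e2 = vec4 (- p) 0 (- y) x"
    "D e3 = vec4 (- x) y 0 q" "D e4 = vec4 (- y) (- x) (- q) 0"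
    by (rule skew_hermitian_form[OF D])
  show ?thesis
  proof (cases "x = 0 \<and> y = 0")
    case True
    then show ?thesis using De by (intro that[of e1 p]) (simp_all add: J4_def)
  next
    case False
    define r where "r = sqrt (((p - q) / 2)\<^sup>2 + x\<^sup>2 + y\<^sup>2)"
    define \<mu> where "\<mu> = (p + q) / 2 + r"
    have "r\<^sup>2 = ((p - q) / 2)\<^sup>2 + x\<^sup>2 + y\<^sup>2" by (simp add: r_def)
    then have \<mu>: "(\<mu> - p) * (\<mu> - q) = x * x + y * y"
      by (simp add: \<mu>_def power2_eq_square field_simps)
    define u where "u = vec4 y x (\<mu> - p) 0"
    have "D u = y *\<^sub>R D e1 + x *\<^sub>R D e2 + (\<mu> - p) *\<^sub>R D e3"
      by (subst linear_vec4_expand[OF D(1)]) (simp add: u_def)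
    then have Du: "D u = \<mu> *\<^sub>R J4 u"
      using \<mu> by (simp add: De J4_def u_def algebra_simps)
    have "u \<noteq> 0" using False by (simp add: u_def)
    then show ?thesis
      using Du linear_scale[OF linear_J4]
      by (intro that[of "(1 / norm u) *\<^sub>R u" \<mu>])
        (simp_all add: linear_scale[OF D(1)] dot_square_norm power2_eq_square)
  qed
qed

text \<open>A quaternionic structure: an isometry with square -1 that anticommutes with
  \<open>J4\<close>. It therefore completes any unit vector to a unitary pair.\<close>

definition perp :: "real^4 \<Rightarrow> real^4" where
  "perp x = vec4 (- x $ 3) (x $ 4) (x $ 1) (- x $ 2)"

lemma unitary_pair_perp:
  assumes "v \<bullet> v = 1"
  shows "unitary_pair J4 (\<bullet>) v (perp v)" "unitary_pair J4 (\<bullet>) (perp v) v"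
  using assms by (simp_all add: unitary_pair_def perp_def J4_def inner_vec4)

text \<open>The zero bracket is the same in every frame, so the frame can be spent on
  \<open>D\<close>: starting it with an eigenvector diagonalizes \<open>D\<close> in u(2).\<close>

lemma classified_abelian4:
  assumes E: "extension_data abelian4 J4 (\<bullet>) D" and na: "D \<noteq> (\<lambda>x. 0)"
  shows "classified_extension abelian4 (\<bullet>) D"
proof -
  have D: "linear D" "\<And>x y. D x \<bullet> y = - (x \<bullet> D y)" "\<And>x. D (J4 x) = J4 (D x)"
    using E unfolding extension_data_def lie_derivation_def by blast+
  obtain v \<mu> where v: "v \<bullet> v = 1" "D v = \<mu> *\<^sub>R J4 v"
    by (rule skew_hermitian_eigenvector[OF D])
  define f where "f = frame J4 v (perp v)"
  have dim: "dim (UNIV :: (real^4) set) = 4" by simp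
  have K: "kaehler abelian4 J4 (\<bullet>)" using E unfolding extension_data_def by blast
  note up = unitary_pair_perp(1)[OF v(1)]
  interpret linear_bij f unfolding f_def by (rule frame_unitary[OF dim K up])
  have Jf: "J4 (f x) = f (J4 x)" for x
    unfolding f_def by (rule frame_unitary[OF dim K up])
  define D' where "D' = inv f \<circ> D \<circ> f"
  have E': "extension_data abelian4 J4 (\<bullet>) D'"
    using frame_pull(1)[OF dim E up] pull_abelian4[OF linear_bij_axioms] by (simp add: f_def D'_def)
  have D'lin: "linear D'" and D': "\<And>x y. D' x \<bullet> y = - (x \<bullet> D' y)" "\<And>x. D' (J4 x) = J4 (D' x)"
    using E' unfolding extension_data_def lie_derivation_def by blast+
  obtain p q x y where De: "D' e1 = vec4 0 p x y" "D' e2 = vec4 (- p) 0 (- y) x"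
    "D' e3 = vec4 (- x) y 0 q" "D' e4 = vec4 (- y) (- x) (- q) 0"
    by (rule skew_hermitian_form[OF D'lin D'])
  have "f e1 = v" by (simp add: f_def frame_def)
  then have "f (D' e1) = \<mu> *\<^sub>R f (J4 e1)" by (simp add: D'_def v Jf[symmetric])
  then have "D' e1 = \<mu> *\<^sub>R J4 e1" by - (rule eqI, simp add: push)
  then have "x = 0" "y = 0" by (simp_all add: De J4_def)
  then have rot: "D' = rot4 p q" using De by (intro rot4_eqI[OF D'lin]) simp_all
  have "p \<noteq> 0 \<or> q \<noteq> 0"
  proof (rule ccontr)
    assume "\<not> (p \<noteq> 0 \<or> q \<noteq> 0)"
    then have "D' x = 0" for x by (simp add: rot rot4_def zero_vec4)
    then have "f (D' (inv f z)) = 0" for z by (simp add: push)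
    then show False using na by (auto simp: D'_def)
  qed
  then have "classified_extension abelian4 (\<bullet>) D'"
    using iso_first_family flat_abelian4 lie_isomorphicI[of id abelian4 abelian4]
    unfolding rot classified_extension_def by (auto simp: linear_id)
  then show ?thesis
    using frame_pull(2)[OF dim E up] pull_abelian4[OF linear_bij_axioms] by (simp add: f_def D'_def)
qed

text \<open>Two changes of frame are composed. The first turns the closed form into the fourth
  coordinate; the second rotates the \<open>e1\<close>, \<open>e2\<close>-plane and fixes
  \<open>e3\<close> and \<open>e4\<close>, so that it keeps this property while diagonalizing the
  upper left block of \<open>L\<close>.\<close>

lemma classified_real4:
  assumes E: "extension_data C J4 (\<bullet>) D" and na: "\<not> lie_abelian (ext_bracket C D)"
  shows "classified_extension C (\<bullet>) D"
proof (cases "C = abelian4")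
  case True
  have "D \<noteq> (\<lambda>x. 0)"
    using na by (auto simp: True lie_abelian_def ext_bracket_def abelian4_def table_bracket_def zero_prod_def)
  then show ?thesis using classified_abelian4 E True by simp
next
  case False
  have dim: "dim (UNIV :: (real^4) set) = 4" by simp
  have "lie_algebra C" using E unfolding extension_data_def kaehler_def by blast
  then obtain g where g: "g \<noteq> 0" "\<And>x y. g \<bullet> C x y = 0" "\<And>x. g \<bullet> x = 0 \<Longrightarrow> ad_trace C x = 0"
    using exists_closed_one_form by blast
  define w where "w = - (1 / norm g) *\<^sub>R J4 g"
  have w: "w \<bullet> w = 1" "J4 w = (1 / norm g) *\<^sub>R g"
    using g(1) inner_J4[of g g] J4_J4[of g]
    by (simp_all add: w_def linear_scale[OF linear_J4] dot_square_norm power2_eq_square linear_neg[OF linear_J4])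
  define f where "f = frame J4 (perp w) w"
  define C' D' where "C' = pull f C" and "D' = inv f \<circ> D \<circ> f"
  note up = unitary_pair_perp(2)[OF w(1)]
  have E': "extension_data C' J4 (\<bullet>) D'" and cl: "classified_extension C' (\<bullet>) D' \<Longrightarrow> classified_extension C (\<bullet>) D"
    using frame_pull[OF dim E up] unfolding C'_def D'_def f_def by blast+
  have ideal: "C' x y $ 4 = 0" and unim: "x $ 4 = 0 \<Longrightarrow> ad_trace C' x = 0" for x y
    using frame_pull_adapted[OF E up g(2,3) w(2)] unfolding C'_def f_def by blast+
  have bC': "bilinear C'" "C' x x = 0" for x
    using E' unfolding extension_data_def kaehler_def lie_algebra_def by blast+
  note sw = bilinear_alternating_swap[OF bC']
  define l1 l2 p where "l1 = C' e2 e3 $ 1" and "l2 = C' e3 e1 $ 2" and "p = C' e2 e3 $ 2"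
  \<comment> \<open>Symmetry of the upper left block, from the trace of
    \<open>ad e3\<close>.\<close>
  have p: "C' e3 e1 $ 1 = p"
    using unim[of e3] ideal[of e3 e4] bC'(2)[of e3] sw[of e3 e2] by (simp add: ad_trace_def p_def)
  obtain c s where cs: "c\<^sup>2 + s\<^sup>2 = 1" "(c\<^sup>2 - s\<^sup>2) * p - c * s * (l1 - l2) = 0"
    "(c\<^sup>2 * l2 - 2 * c * s * p + s\<^sup>2 * l1)\<^sup>2 \<le> (c\<^sup>2 * l1 + 2 * c * s * p + s\<^sup>2 * l2)\<^sup>2"
    by (rule exists_diagonalizing_rotation)
  define v where "v = vec4 c s 0 0"
  have up': "unitary_pair J4 (\<bullet>) v e3"
    using cs(1) by (simp add: unitary_pair_def v_def J4_def power2_eq_square)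
  define h where "h = frame J4 v e3"
  define C2 D2 where "C2 = pull h C'" and "D2 = inv h \<circ> D' \<circ> h"
  have E2: "extension_data C2 J4 (\<bullet>) D2" and cl2: "classified_extension C2 (\<bullet>) D2 \<Longrightarrow> classified_extension C' (\<bullet>) D'"
    using frame_pull[OF dim E' up'] unfolding C2_def D2_def h_def by blast+
  have g2: "e4 \<bullet> C' x y = 0" "e4 \<bullet> x = 0 \<Longrightarrow> ad_trace C' x = 0" "J4 e3 = 1 *\<^sub>R e4" for x y
    using ideal unim by (simp_all add: inner_vec4 J4_def)
  have ideal2: "C2 x y $ 4 = 0" and unim2: "x $ 4 = 0 \<Longrightarrow> ad_trace C2 x = 0"
    and C2: "C2 x y \<bullet> z = C' (h x) (h y) \<bullet> h z" for x y z
    using frame_pull_adapted[OF E' up' g2] unfolding C2_def h_def by blast+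
  have he: "h e1 = vec4 c s 0 0" "h e2 = vec4 (- s) c 0 0" "h e3 = e3"
    by (simp_all add: h_def frame_def v_def J4_def)
  have bil: "C' (vec4 a b 0 0) e3 = b *\<^sub>R C' e2 e3 - a *\<^sub>R C' e3 e1" "C' e3 (vec4 a b 0 0) = a *\<^sub>R C' e3 e1 - b *\<^sub>R C' e2 e3" for a b
  proof -
    have l: "linear (C' e3)" using bC' by (simp add: bilinear_def)
    show "C' e3 (vec4 a b 0 0) = a *\<^sub>R C' e3 e1 - b *\<^sub>R C' e2 e3"
      by (subst linear_vec4_expand[OF l]) (simp add: sw[of e3 e2])
    then show "C' (vec4 a b 0 0) e3 = b *\<^sub>R C' e2 e3 - a *\<^sub>R C' e3 e1"
      by (subst sw) simp
  qed
  have "C2 e2 e3 $ 2 = C2 e2 e3 \<bullet> e2" "C2 e2 e3 $ 1 = C2 e2 e3 \<bullet> e1" "C2 e3 e1 $ 2 = C2 e3 e1 \<bullet> e2"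
    by (simp_all add: inner_vec4)
  then have l': "C2 e2 e3 $ 2 = (c\<^sup>2 - s\<^sup>2) * p - c * s * (l1 - l2)"
    "C2 e2 e3 $ 1 = c\<^sup>2 * l1 + 2 * c * s * p + s\<^sup>2 * l2" "C2 e3 e1 $ 2 = c\<^sup>2 * l2 - 2 * c * s * p + s\<^sup>2 * l1"
    unfolding C2 he bil[of "- s" c] bil[of c s] by (simp_all add: inner_vec4 p power2_eq_square algebra_simps flip: l1_def l2_def p_def)
  have nonab: "C2 \<noteq> abelian4"
  proof
    interpret h: linear_bij h
      using E' up' unfolding h_def extension_data_def by (intro frame_unitary(1)[OF dim]) auto
    interpret f: linear_bij f
      using E up unfolding f_def extension_data_def by (intro frame_unitary(1)[OF dim]) auto
    assume "C2 = abelian4"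
    then have "h (C2 (inv h x) (inv h y)) = 0" for x y
      by (simp add: abelian4_def table_bracket_def h.push)
    then have "C' x y = 0" for x y by (simp add: C2_def pull_def)
    then have "f (C' (inv f x) (inv f y)) = 0" for x y by (simp add: f.push)
    then have "C x y = 0" for x y by (simp add: C'_def pull_def)
    then show False using False by (auto simp: abelian4_def table_bracket_def fun_eq_iff)
  qed
  show ?thesis
  proof (rule cl, rule cl2, rule classified_normal_form[OF E2 nonab ideal2])
    show "C2 x e1 $ 1 + C2 x e2 $ 2 + C2 x e3 $ 3 = 0" if "x $ 4 = 0" for x
      using unim2[OF that] ideal2 by (simp add: ad_trace_def)
    show "C2 e2 e3 $ 2 = 0" "(C2 e3 e1 $ 2)\<^sup>2 \<le> (C2 e2 e3 $ 1)\<^sup>2"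
      using cs unfolding l' by simp_all
  qed
qed

lemma classified_extension_dim4:
  fixes C :: "'a::real_vector \<Rightarrow> 'a \<Rightarrow> 'a"
  assumes dim: "dim (UNIV :: 'a set) = 4" and E: "extension_data C J ip D"
    and na: "\<not> lie_abelian (ext_bracket C D)"
  shows "classified_extension C ip D"
proof -
  have K: "kaehler C J ip" using E unfolding extension_data_def by blast
  obtain v w where up: "unitary_pair J ip v w" by (rule exists_unitary_pair[OF dim K])
  define f where "f = frame J v w"
  interpret linear_bij f unfolding f_def by (rule frame_unitary[OF dim K up])
  have "\<not> lie_abelian (ext_bracket (pull f C) (inv f \<circ> D \<circ> f))"
    using na lie_abelian_transfer[OF lie_isomorphic_ext_pull] by blast
  then have "classified_extension (pull f C) (\<bullet>) (inv f \<circ> D \<circ> f)"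
    using frame_pull(1)[OF dim E up] unfolding f_def by (intro classified_real4)
  then show ?thesis using frame_pull(2)[OF dim E up] unfolding f_def by blast
qed

section \<open>Reduction of coKaehler Lie algebras to extensions\<close>

text \<open>The kernel of \<open>\<alpha>\<close> is only a subset of the given type; parametrizing
  it by \<open>real^4\<close> supplies the type on which the Kaehler algebra lives.\<close>

lemma hyperplane_parametrization:
  fixes \<alpha> :: "'g::real_vector \<Rightarrow> real" and \<xi> :: 'g
  assumes a: "linear \<alpha>" "\<alpha> \<xi> = 1" and dim: "dim (UNIV :: 'g set) = 5"
  obtains \<phi> :: "real^4 \<Rightarrow> 'g" where "linear \<phi>" "inj \<phi>" "range \<phi> = {x. \<alpha> x = 0}"
proof -
  define S where "S = {x. \<alpha> x = 0}"
  have sub: "subspace S"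
    by (auto simp: S_def subspace_def linear_0[OF a(1)] linear_add[OF a(1)] linear_scale[OF a(1)])
  obtain b where b: "b \<subseteq> S" "independent b" "S \<subseteq> span b" using basis_exists[of S] by metis
  have sb: "span b = S" using span_minimal[OF b(1) sub] b(3) by blast
  have ind: "independent (insert \<xi> b)" and notin: "\<xi> \<notin> b"
    using b sb a(2) by (auto simp: independent_insert S_def)
  have "x \<in> span (insert \<xi> b)" for x
  proof -
    have "x - \<alpha> x *\<^sub>R \<xi> \<in> span b"
      using a by (simp add: sb S_def linear_diff[OF a(1)] linear_scale[OF a(1)])
    then show ?thesis by (auto simp: span_breakdown_eq)
  qed
  then have span: "span (insert \<xi> b) = UNIV" by auto
  have "card (insert \<xi> b) = 5"
    using dim_eq_card[OF _ ind, of UNIV] span dim by simp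
  moreover from this have "finite b" by (metis card.infinite finite_insert zero_neq_numeral)
  ultimately have "card b = card (Basis :: (real^4) set)" using notin by simp
  then obtain h where h: "bij_betw h (Basis :: (real^4) set) b"
    using \<open>finite b\<close> finite_Basis by (metis bij_betw_iff_card)
  obtain \<phi> where \<phi>: "linear \<phi>" "\<And>x. x \<in> Basis \<Longrightarrow> \<phi> x = h x"
    using linear_independent_extend[OF independent_Basis, of h] by blast
  have im: "\<phi> ` Basis = b" using \<phi>(2) h by (auto simp: bij_betw_def)
  have "inj_on \<phi> Basis" using \<phi>(2) h by (auto simp: bij_betw_def inj_on_def)
  then have "inj_on \<phi> (span Basis)"
    using b(2) im by (intro linear_inj_on_span_independent_image[OF \<phi>(1)]) simp_all
  then have "inj \<phi>" by simp
  moreover have "range \<phi> = S"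
    using linear_span_image[OF \<phi>(1), of Basis] im sb by simp
  ultimately show ?thesis using that \<phi>(1) by (simp add: S_def)
qed

lemma cokaehler_is_extension:
  fixes B :: "'g::real_vector \<Rightarrow> 'g \<Rightarrow> 'g"
  assumes cok: "cokaehler B J \<xi> \<alpha> ip" and dim: "dim (UNIV :: 'g set) = 5"
  obtains C :: "real^4 \<Rightarrow> real^4 \<Rightarrow> real^4" and J' ip' D
  where "extension_data C J' ip' D" "lie_isomorphic (ext_bracket C D) B"
proof -
  have la: "lie_algebra B" and lJ: "linear J" and a: "linear \<alpha>" "\<alpha> \<xi> = 1" and IP: "inner_product ip"
    and J2: "\<And>X. J (J X) = - X + \<alpha> X *\<^sub>R \<xi>"
    and iJ: "\<And>X Y. ip (J X) (J Y) = ip X Y - \<alpha> X * \<alpha> Y" and "\<And>X Y. ce_d1 B \<alpha> X Y = 0"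
    and N: "\<And>X Y. nijenhuis B J X Y = 0" and w: "\<And>X Y Z. ce_d2 B (\<lambda>X Y. ip (J X) Y) X Y Z = 0"
    and xi0: "\<xi> \<noteq> 0"
    using cok unfolding cokaehler_def by blast+
  then have aB: "\<alpha> (B X Y) = 0" for X Y by (simp add: ce_d1_def)
  have bB: "bilinear B" "\<And>x. B x x = 0" and jac: "\<And>x y z. B x (B y z) + B y (B z x) + B z (B x y) = 0"
    using la unfolding lie_algebra_def by blast+
  have bi: "bilinear ip" and sym: "\<And>x y. ip x y = ip y x" and pos: "\<And>x. x \<noteq> 0 \<Longrightarrow> ip x x > 0"
    using IP unfolding inner_product_def by blast+
  note sw = bilinear_alternating_swap[OF bB]
  \<comment> \<open>\<open>J (J (J X))\<close> is computed in two ways, expanding the inner or the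
    outer square.\<close>
  have aJ\<xi>: "\<alpha> X *\<^sub>R J \<xi> = \<alpha> (J X) *\<^sub>R \<xi>" for X
    using arg_cong[OF J2[of X], of J] J2[of "J X"]
    by (simp add: linear_add[OF lJ] linear_diff[OF lJ] linear_scale[OF lJ] linear_neg[OF lJ])
  have J\<xi>: "J \<xi> = 0"
  proof -
    define k where "k = \<alpha> (J \<xi>)"
    have "J \<xi> = k *\<^sub>R \<xi>" using aJ\<xi>[of \<xi>] a(2) by (simp add: k_def)
    moreover from this have "(k * k) *\<^sub>R \<xi> = 0" using J2[of \<xi>] a(2) by (simp add: linear_scale[OF lJ])
    ultimately show ?thesis using xi0 by simp
  qed
  have aJ: "\<alpha> (J X) = 0" for X using aJ\<xi>[of X] J\<xi> xi0 by simp
  \<comment> \<open>Hence \<open>\<xi>\<close> is a unit vector orthogonal to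
    \<open>ker \<alpha>\<close>.\<close>
  have ip\<xi>: "ip X \<xi> = \<alpha> X" for X using iJ[of X \<xi>] a(2) by (simp add: J\<xi> bilinear_rzero[OF bi])
  obtain \<phi> :: "real^4 \<Rightarrow> 'g" where \<phi>: "linear \<phi>" "inj \<phi>" "range \<phi> = {x. \<alpha> x = 0}"
    by (rule hyperplane_parametrization[OF a dim])
  have a\<phi>[simp]: "\<alpha> (\<phi> x) = 0" for x using \<phi>(3) by auto
  define \<psi> where "\<psi> = inv \<phi>"
  have \<psi>[simp]: "\<psi> (\<phi> x) = x" for x by (simp add: \<psi>_def \<phi>(2))
  have \<phi>\<psi>: "\<phi> (\<psi> z) = z" if "\<alpha> z = 0" for z
    unfolding \<psi>_def using that \<phi>(3) by (intro f_inv_into_f) auto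
  have eqI: "x = y" if "\<phi> x = \<phi> y" for x y using \<phi>(2) that by (simp add: inj_eq)
  note push = linear_add[OF \<phi>(1)] linear_diff[OF \<phi>(1)] linear_neg[OF \<phi>(1)] linear_scale[OF \<phi>(1)] linear_0[OF \<phi>(1)]
  note Bs = bilinear_ladd[OF bB(1)] bilinear_radd[OF bB(1)] bilinear_lmul[OF bB(1)] bilinear_rmul[OF bB(1)]
  define C D J' where "C x y = \<psi> (B (\<phi> x) (\<phi> y))" and "D x = \<psi> (B \<xi> (\<phi> x))" and "J' x = \<psi> (J (\<phi> x))" for x y
  define ip' where "ip' x y = ip (\<phi> x) (\<phi> y)" for x y
  have pC[simp]: "\<phi> (C x y) = B (\<phi> x) (\<phi> y)" for x y by (simp add: C_def \<phi>\<psi> aB)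
  have pD[simp]: "\<phi> (D x) = B \<xi> (\<phi> x)" for x by (simp add: D_def \<phi>\<psi> aB)
  have pJ[simp]: "\<phi> (J' x) = J (\<phi> x)" for x by (simp add: J'_def \<phi>\<psi> aJ)
  have lC: "lie_algebra C"
    unfolding lie_algebra_def bilinear_def
  proof (intro conjI allI linearI)
    show "C x (C y z) + C y (C z x) + C z (C x y) = 0" for x y z
      by (rule eqI) (simp add: push jac)
    show "C x x = 0" for x by (rule eqI) (simp add: push bB)
  qed (rule eqI, simp add: push Bs)+
  have lJ': "linear J'"
    by (rule linearI; rule eqI) (simp_all add: push linear_add[OF lJ] linear_scale[OF lJ])
  have lD: "linear D"
    by (rule linearI; rule eqI) (simp_all add: push Bs)
  have \<phi>0: "\<phi> x \<noteq> 0" if "x \<noteq> 0" for x using eqI[of x 0] that by (auto simp: push)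
  have IP': "inner_product ip'"
    unfolding inner_product_def bilinear_def
  proof (intro conjI allI impI)
    show "ip' x y = ip' y x" for x y unfolding ip'_def by (rule sym)
    show "ip' x x > 0" if "x \<noteq> 0" for x unfolding ip'_def by (rule pos[OF \<phi>0[OF that]])
    show "linear (ip' x)" for x
      by (rule linearI) (simp_all add: ip'_def push bilinear_radd[OF bi] bilinear_rmul[OF bi])
    show "linear (\<lambda>x. ip' x y)" for y
      by (rule linearI) (simp_all add: ip'_def push bilinear_ladd[OF bi] bilinear_lmul[OF bi])
  qed
  have K: "kaehler C J' ip'"
    unfolding kaehler_def
  proof (intro conjI allI)
    show "J' (J' x) = - x" for x by (rule eqI) (simp add: push J2)
    show "ip' (J' x) (J' y) = ip' x y" for x y by (simp add: ip'_def iJ)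
    show "nijenhuis C J' x y = 0" for x y
      using N[of "\<phi> x" "\<phi> y"] by (intro eqI[of _ 0]) (simp add: nijenhuis_def push)
    show "ce_d2 C (\<lambda>X Y. ip' (J' X) Y) x y z = 0" for x y z
      using w[of "\<phi> x" "\<phi> y" "\<phi> z"] by (simp add: ce_d2_def ip'_def)
  qed (rule lC lJ' IP')+
  have der: "lie_derivation C D"
    unfolding lie_derivation_def
  proof (intro conjI allI)
    show "D (C x y) = C (D x) y + C x (D y)" for x y
    proof (rule eqI)
      have "B \<xi> (B (\<phi> x) (\<phi> y)) = - B (\<phi> x) (B (\<phi> y) \<xi>) - B (\<phi> y) (B \<xi> (\<phi> x))"
        using jac[of \<xi> "\<phi> x" "\<phi> y"] by (simp add: eq_neg_iff_add_eq_0 algebra_simps)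
      then show "\<phi> (D (C x y)) = \<phi> (C (D x) y + C x (D y))"
        using sw[of "\<phi> y" \<xi>] sw[of "\<phi> y" "B \<xi> (\<phi> x)"] by (simp add: push bilinear_rneg[OF bB(1)])
    qed
  qed (rule lD)
  have DJ: "D (J' x) = J' (D x)" for x
  proof (rule eqI)
    \<comment> \<open>With \<open>J \<xi> = 0\<close> the Nijenhuis tensor at \<open>\<xi>\<close>
      has only two terms. One more application of \<open>J\<close>, whose square is -1 on
      \<open>ker \<alpha>\<close>, yields the commutation.\<close>
    have "J (J (B \<xi> (\<phi> x))) = J (B \<xi> (J (\<phi> x)))"
      using N[of \<xi> "\<phi> x"] by (simp add: nijenhuis_def J\<xi> bilinear_lzero[OF bB(1)] linear_0[OF lJ])
    then have "J (J (J (B \<xi> (\<phi> x)))) = J (J (B \<xi> (J (\<phi> x))))" by simp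
    then show "\<phi> (D (J' x)) = \<phi> (J' (D x))"
      by (simp add: J2[of "B _ _"] J2[of "J (B _ _)"] aB aJ linear_neg[OF lJ])
  qed
  \<comment> \<open>Closedness of \<open>\<omega>\<close> at \<open>\<xi>\<close> makes
    \<open>J D\<close> symmetric; as \<open>J\<close> is skew and commutes with \<open>D\<close>,
    this makes \<open>D\<close> skew.\<close>
  have w\<xi>: "ip (J (B \<xi> Y)) Z = ip (J (B \<xi> Z)) Y" for Y Z
    using w[of \<xi> Y Z] by (simp add: ce_d2_def ip\<xi> aJ)
  have skew: "ip' (D x) y = - ip' x (D y)" for x y
  proof -
    have "ip (B \<xi> (\<phi> x)) (\<phi> y) = ip (J (B \<xi> (\<phi> x))) (J (\<phi> y))" by (simp add: iJ)
    also have "\<dots> = ip (J (B \<xi> (J (\<phi> y)))) (\<phi> x)" by (rule w\<xi>)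
    also have "J (B \<xi> (J (\<phi> y))) = \<phi> (J' (D (J' y)))" by simp
    also have "J' (D (J' y)) = - D y" using K DJ unfolding kaehler_def by metis
    finally show ?thesis using sym[of "\<phi> x"] by (simp add: ip'_def push bilinear_lneg[OF bi])
  qed
  have E: "extension_data C J' ip' D"
    unfolding extension_data_def using K der skew DJ by blast
  define \<Phi> where "\<Phi> u = fst u *\<^sub>R \<xi> + \<phi> (snd u)" for u
  have "lie_isomorphic (ext_bracket C D) B"
  proof (rule lie_isomorphicI[of \<Phi>])
    show "linear \<Phi>" by (rule linearI) (simp_all add: \<Phi>_def push algebra_simps)
    show "bij \<Phi>"
    proof (rule bijI')
      show "\<Phi> u = \<Phi> v \<longleftrightarrow> u = v" for u v
      proof
        assume *: "\<Phi> u = \<Phi> v"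
        then have "\<alpha> (\<Phi> u) = \<alpha> (\<Phi> v)" by simp
        then have "fst u = fst v" by (simp add: \<Phi>_def linear_add[OF a(1)] linear_scale[OF a(1)] a(2))
        then show "u = v" using * eqI by (auto simp: \<Phi>_def prod_eq_iff)
      qed simp
      show "\<exists>u. z = \<Phi> u" for z
      proof -
        have "\<alpha> (z - \<alpha> z *\<^sub>R \<xi>) = 0" by (simp add: linear_diff[OF a(1)] linear_scale[OF a(1)] a(2))
        then have "z = \<Phi> (\<alpha> z, \<psi> (z - \<alpha> z *\<^sub>R \<xi>))" by (simp add: \<Phi>_def \<phi>\<psi>)
        then show ?thesis by blast
      qed
    qed
    show "\<Phi> (ext_bracket C D u v) = B (\<Phi> u) (\<Phi> v)" for u v
      using sw[of _ \<xi>] by (cases u; cases v) (simp add: \<Phi>_def ext_bracket_def push Bs bB sw[of "\<phi> _" \<xi>])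
  qed
  then show ?thesis using E by (rule that[rotated])
qed

lemma cokaehler_classification:
  fixes B :: "'g::real_vector \<Rightarrow> 'g \<Rightarrow> 'g"
  assumes cok: "cokaehler B J \<xi> \<alpha> ip" and dim: "dim (UNIV :: 'g set) = 5" and na: "\<not> lie_abelian B"
  shows "\<exists>M \<in> first_family \<union> remaining_lines. lie_isomorphic B M"
proof -
  obtain C :: "real^4 \<Rightarrow> real^4 \<Rightarrow> real^4" and J' ip' D
    where E: "extension_data C J' ip' D" and iso: "lie_isomorphic (ext_bracket C D) B"
    by (rule cokaehler_is_extension[OF cok dim])
  have "\<not> lie_abelian (ext_bracket C D)" using na lie_abelian_transfer[OF iso] by blast
  then have "classified_extension C ip' D" using E by (intro classified_extension_dim4) simp_all
  then show ?thesis
    unfolding classified_extension_def using lie_isomorphic_trans[OF lie_isomorphic_sym[OF iso]] by blast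
qed

section \<open>Every listed algebra occurs, and flatness is decided by the Kaehler algebra\<close>

lemma nonflat_model:
  assumes "extension_data C J4 (\<bullet>) D" "lie_isomorphic (ext_bracket C D) M" "has_ad_eigenvector C"
  shows "\<exists>(C :: real^4 \<Rightarrow> real^4 \<Rightarrow> real^4) J ip D.
        extension_data C J ip D \<and> \<not> lie_abelian (ext_bracket C D) \<and>
        \<not> flat_metric (ext_bracket C D) (ext_inner ip) \<and> lie_isomorphic (ext_bracket C D) M"
proof -
  have "linear D" using assms unfolding extension_data_def lie_derivation_def by blast
  then have ev: "has_ad_eigenvector (ext_bracket C D)" using assms has_ad_eigenvector_ext by blast
  then have "\<not> lie_abelian (ext_bracket C D)"
    unfolding has_ad_eigenvector_def lie_abelian_def by metis
  moreover have "\<not> flat_metric (ext_bracket C D) (ext_inner (\<bullet>))"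
    using ev flat_metric_no_ad_eigenvector unfolding ext_inner_inner by blast
  ultimately show ?thesis using assms by blast
qed

lemma remaining_lines_models:
  assumes "M \<in> remaining_lines"
  shows "\<exists>(C :: real^4 \<Rightarrow> real^4 \<Rightarrow> real^4) J ip D.
        extension_data C J ip D \<and> \<not> lie_abelian (ext_bracket C D) \<and>
        \<not> flat_metric (ext_bracket C D) (ext_inner ip) \<and> lie_isomorphic (ext_bracket C D) M"
proof -
  note ev = has_ad_eigenvector_normal
  consider "M = \<gg>1" | "M = \<gg>5" | "M = \<gg>2" | "M = \<gg>3" | "M = \<gg>4" | "M = \<gg>7"
    | \<delta> where "M = \<gg>6_fam \<delta>" "\<delta> > 0" | \<delta> where "M = \<gg>8_fam \<delta>" "\<delta> > 0"
    using assms unfolding remaining_lines_def by blast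
  then show ?thesis
  proof cases
    case 1
    show ?thesis unfolding 1 using nonflat_model[OF extension_data_r'4 iso_g1[of 1 1 0] ev(1)] by simp
  next
    case 2
    show ?thesis unfolding 2 using nonflat_model[OF extension_data_r'4 iso_g5[of 1] ev(1)] by simp
  next
    case 3
    show ?thesis unfolding 3
      \<comment> \<open>The instance \<open>l = 1\<close>, \<open>u = 0\<close>,
        \<open>s = 2 l\<close>; the product \<open>2 * 1\<close> keeps the shape required by the
        Kaehler data.\<close>
      using nonflat_model[OF extension_data_r2r2 iso_g2[of 1 "2 * 1" 0] has_ad_eigenvector_r2r2] by simp
  next
    case 4
    show ?thesis unfolding 4 using nonflat_model[OF extension_data_d42 iso_g3[of 1] ev(3)] by simp
  next
    case 5
    show ?thesis unfolding 5 using nonflat_model[OF extension_data_d4 iso_g4[of 1 1 0] ev(2)] by simp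
  next
    case 6
    show ?thesis unfolding 6 using nonflat_model[OF extension_data_d4 iso_g7[of 1] ev(2)] by simp
  next
    case (7 \<delta>)
    then show ?thesis using nonflat_model[OF extension_data_r'4 iso_g6[of 1 \<delta>] ev(1)] by simp
  next
    case (8 \<delta>)
    then show ?thesis using nonflat_model[OF extension_data_d4 iso_g8[of \<delta> 1] ev(2)] by simp
  qed
qed

lemma not_lie_abelian_first_family:
  assumes "M \<in> first_family"
  shows "\<not> lie_abelian M"
proof -
  obtain a where "M = \<gg>1_fam a" using assms unfolding first_family_def by blast
  then have "M (\<ee> 5) (\<ee> 2) = \<ee> 1" by (simp add: \<gg>1_fam_def table_bracket_def axis_def)
  then show ?thesis unfolding lie_abelian_def by (metis axis_eq_0_iff zero_neq_one)
qed

lemma first_family_models: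
  assumes "M \<in> first_family"
  shows "\<exists>J ip D. extension_data abelian4 J ip D \<and> \<not> lie_abelian (ext_bracket abelian4 D) \<and>
        flat_metric (ext_bracket abelian4 D) (ext_inner ip) \<and> lie_isomorphic (ext_bracket abelian4 D) M"
proof -
  obtain a where M: "M = \<gg>1_fam a" using assms unfolding first_family_def by blast
  have iso: "lie_isomorphic (ext_bracket abelian4 (rot4 1 a)) M" using iso_g1_fam[of 1 a] M by simp
  then have "\<not> lie_abelian (ext_bracket abelian4 (rot4 1 a))"
    using not_lie_abelian_first_family[OF assms] lie_abelian_transfer by blast
  then show ?thesis using iso extension_data_abelian4 flat_abelian4 by blast
qed

lemma rr'_3_0_model:
  "\<exists>J ip D. extension_data rr'_3_0 J ip D \<and> \<not> lie_abelian (ext_bracket rr'_3_0 D) \<and>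
        flat_metric (ext_bracket rr'_3_0 D) (ext_inner ip)"
proof -
  have "ext_bracket rr'_3_0 (\<lambda>x. 0) (0, e1) (0, e3) \<noteq> 0"
    by (simp add: ext_bracket_def rr'_3_0_def table_bracket_def axis_vec4 zero_prod_def)
  then have "\<not> lie_abelian (ext_bracket rr'_3_0 (\<lambda>x. 0))" unfolding lie_abelian_def by blast
  then show ?thesis using extension_data_rr'_3_0 flat_rr'_3_0 by blast
qed

text \<open>The two alternatives of \<open>classified_extension\<close> exclude each other, since
  neither \<open>abelian4\<close> nor \<open>rr'_3_0\<close> has an ad-eigenvector; this gives the
  equivalence from right to left.\<close>

lemma extension_flat_iff:
  fixes C :: "'h::real_vector \<Rightarrow> 'h \<Rightarrow> 'h"
  assumes "dim (UNIV :: 'h set) = 4" "extension_data C J ip D" "\<not> lie_abelian (ext_bracket C D)"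
  shows "flat_metric (ext_bracket C D) (ext_inner ip) \<longleftrightarrow> lie_isomorphic C abelian4 \<or> lie_isomorphic C rr'_3_0"
    "flat_metric (ext_bracket C D) (ext_inner ip) \<Longrightarrow> \<exists>M \<in> first_family. lie_isomorphic (ext_bracket C D) M"
    "\<not> flat_metric (ext_bracket C D) (ext_inner ip) \<Longrightarrow> \<exists>M \<in> remaining_lines. lie_isomorphic (ext_bracket C D) M"
  using classified_extension_dim4[OF assms] not_has_ad_eigenvector_abelian4 not_has_ad_eigenvector_rr'_3_0
  unfolding classified_extension_def by (meson has_ad_eigenvector_transfer)+

theorem proposition5p5:
  fixes B :: "'g::real_vector \<Rightarrow> 'g \<Rightarrow> 'g"
  shows
    "(lie_algebra B \<and> dim (UNIV :: 'g set) = 5 \<and> \<not> lie_abelian B \<and>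
        (\<exists>J \<xi> \<alpha> ip. cokaehler B J \<xi> \<alpha> ip)
      \<longrightarrow> (\<exists>M \<in> first_family \<union> remaining_lines. lie_isomorphic B M))
   \<and> (\<forall>(C :: 'h::real_vector \<Rightarrow> 'h \<Rightarrow> 'h) J ip D.
        dim (UNIV :: 'h set) = 4 \<and> extension_data C J ip D \<and> \<not> lie_abelian (ext_bracket C D)
      \<longrightarrow> (flat_metric (ext_bracket C D) (ext_inner ip)
             \<longleftrightarrow> lie_isomorphic C abelian4 \<or> lie_isomorphic C rr'_3_0)
        \<and> (flat_metric (ext_bracket C D) (ext_inner ip)
             \<longrightarrow> (\<exists>M \<in> first_family. lie_isomorphic (ext_bracket C D) M))
        \<and> (\<not> flat_metric (ext_bracket C D) (ext_inner ip)
             \<longrightarrow> (\<exists>M \<in> remaining_lines. lie_isomorphic (ext_bracket C D) M)))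
   \<and> (\<forall>M \<in> first_family. \<exists>C \<in> {abelian4, rr'_3_0}. \<exists>J ip D.
        extension_data C J ip D \<and> \<not> lie_abelian (ext_bracket C D) \<and>
        flat_metric (ext_bracket C D) (ext_inner ip) \<and> lie_isomorphic (ext_bracket C D) M)
   \<and> (\<forall>C \<in> {abelian4, rr'_3_0}. \<exists>J ip D.
        extension_data C J ip D \<and> \<not> lie_abelian (ext_bracket C D) \<and>
        flat_metric (ext_bracket C D) (ext_inner ip))
   \<and> (\<forall>M \<in> remaining_lines. \<exists>(C :: real^4 \<Rightarrow> real^4 \<Rightarrow> real^4) J ip D.
        extension_data C J ip D \<and> \<not> lie_abelian (ext_bracket C D) \<and>
        \<not> flat_metric (ext_bracket C D) (ext_inner ip) \<and> lie_isomorphic (ext_bracket C D) M)"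
proof (rule conjI, use cokaehler_classification in blast, rule conjI)
  show "\<forall>(C :: 'h \<Rightarrow> 'h \<Rightarrow> 'h) J ip D.
        dim (UNIV :: 'h set) = 4 \<and> extension_data C J ip D \<and> \<not> lie_abelian (ext_bracket C D)
      \<longrightarrow> (flat_metric (ext_bracket C D) (ext_inner ip)
             \<longleftrightarrow> lie_isomorphic C abelian4 \<or> lie_isomorphic C rr'_3_0)
        \<and> (flat_metric (ext_bracket C D) (ext_inner ip)
             \<longrightarrow> (\<exists>M \<in> first_family. lie_isomorphic (ext_bracket C D) M))
        \<and> (\<not> flat_metric (ext_bracket C D) (ext_inner ip)
             \<longrightarrow> (\<exists>M \<in> remaining_lines. lie_isomorphic (ext_bracket C D) M))"
    by (intro allI impI, elim conjE) (intro conjI impI; rule extension_flat_iff; assumption)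
next
  have "\<gg>1_fam 0 \<in> first_family" unfolding first_family_def by auto
  then have "\<forall>C \<in> {abelian4, rr'_3_0}. \<exists>J ip D. extension_data C J ip D \<and>
      \<not> lie_abelian (ext_bracket C D) \<and> flat_metric (ext_bracket C D) (ext_inner ip)"
    using first_family_models rr'_3_0_model by blast
  moreover have "\<forall>M \<in> first_family. \<exists>C \<in> {abelian4, rr'_3_0}. \<exists>J ip D.
        extension_data C J ip D \<and> \<not> lie_abelian (ext_bracket C D) \<and>
        flat_metric (ext_bracket C D) (ext_inner ip) \<and> lie_isomorphic (ext_bracket C D) M"
    using first_family_models by blast
  ultimately show "(\<forall>M \<in> first_family. \<exists>C \<in> {abelian4, rr'_3_0}. \<exists>J ip D.
        extension_data C J ip D \<and> \<not> lie_abelian (ext_bracket C D) \<and>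
        flat_metric (ext_bracket C D) (ext_inner ip) \<and> lie_isomorphic (ext_bracket C D) M)
   \<and> (\<forall>C \<in> {abelian4, rr'_3_0}. \<exists>J ip D.
        extension_data C J ip D \<and> \<not> lie_abelian (ext_bracket C D) \<and>
        flat_metric (ext_bracket C D) (ext_inner ip))
   \<and> (\<forall>M \<in> remaining_lines. \<exists>(C :: real^4 \<Rightarrow> real^4 \<Rightarrow> real^4) J ip D.
        extension_data C J ip D \<and> \<not> lie_abelian (ext_bracket C D) \<and>
        \<not> flat_metric (ext_bracket C D) (ext_inner ip) \<and> lie_isomorphic (ext_bracket C D) M)"
    using remaining_lines_models by (intro conjI ballI) auto
qed

end
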